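(* For every $N\in\mathbb{N}_+$, $\lambda\in\mathbb{R}$ and $n\in\mathbb{N}$, the $n$-th moment $m_n(\lambda,N)=\varphi\big(S_N(\lambda)^n\big)$ of $S_N(\lambda)$ with respect to the vacuum state $\varphi$ is given by $$m_n(\lambda,N)=\sum_{k=0}^{\lfloor n/2\rfloor}\frac{|\mathcal{LV}^{2+}_N(n,k)|}{N^k}\,\lambda^{n-2k}.$$
   Context: Notation: $\mathbb{N}=\{0,1,2,\dots\}$, $\mathbb{N}_+=\{1,2,\dots\}$, $[n]=\{1,\dots,n\}$, $[0]=\emptyset$; $\lambda^0=1$ for all $\lambda$, including $\lambda=0$. Operators. A finite word $(i_1,\dots,i_n)$ over $\mathbb{N}$ is a V-word if $n=0$ or there is $m\in[n]$ with $i_1>\dots>i_m<\dots<i_n$; let $\mathcal{V}$ be the set of V-words. The discrete V-monotone Fock space $\mathcal{F}$ is the complex Hilbert space with orthonormal basis $(e_w)_{w\in\mathcal V}$; $\Omega=e_{()}$ is the vacuum vector, and $e_w=0$ for words $w\notin\mathcal V$. For $i\in\mathbb{N}$ the bounded operators $A_i^+,A_i^-,A_i^\circ$ on $\mathcal F$ (creation, annihilation, conservation) are determined by: $A_i^+e_w=e_{(i,w)}$ (concatenation) for $w\in\mathcal V$; $A_i^-\Omega=A_i^\circ\Omega=0$; and for $w=(j,w_0)\in\mathcal V$, $A_i^-e_w=\delta_{i,j}e_{w_0}$ and $A_i^\circ e_w=\delta_{i,j}e_w$. The vacuum state is $\varphi(b)=\langle b\,\Omega,\Omega\rangle$. Put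 $$S_N(\lambda)=\sum_{i=1}^N\Big(\frac{A_i^++A_i^-}{\sqrt N}+\lambda A_i^\circ\Big).$$ Partitions. $\mathcal{NC}^{2+}(n)$ is the set of noncrossing partitions of $[n]$ all of whose blocks have at least two elements ($\mathcal{NC}^{2+}(0)=\{\emptyset\}$). For blocks $B,B'$ of $\pi$ write $B'\prec_\pi B$ if $B$ lies strictly between two consecutive elements of $B'$, i.e. $l_{q-1}<\min B\le\max B<l_q$ for some $q\in[p]$, where $B'=\{l_0<\dots<l_p\}$. A labeled partition is a pair $(\pi,\mathrm L)$ with $\mathrm L$ a function on the blocks of $\pi$ with values in $\mathbb{N}$. It is V-monotonically labeled if for every maximal chain $B_1\prec_\pi\dots\prec_\pi B_r$ of $(\pi,\prec_\pi)$ the word $(\mathrm L(B_r),\dots,\mathrm L(B_1))$ is a V-word. $\mathcal{LV}_N^{2+}(n,k)$ is the set of all V-monotonically labeled $(\pi,\mathrm L)$ such that $\pi\in\mathcal{NC}^{2+}(n)$ has exactly $k$ blocks and $\mathrm L:\pi\to[N]$; by convention $\mathcal{LV}_N^{2+}(0,0)=\{\emptyset\}$. *)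

theory Defs
  imports "HOL-Analysis.Analysis" "HOL-Library.Disjoint_Sets" "HOL-Library.FuncSet"
begin

section \<open>V-words\<close>

definition vword :: "nat list \<Rightarrow> bool" where
  "vword w \<longleftrightarrow> w = [] \<or>
     (\<exists>m\<in>{1..length w}. sorted_wrt (>) (take m w) \<and> sorted_wrt (<) (drop (m - 1) w))"

lemma vword_Nil [simp]: "vword []"
  by (simp add: vword_def)

lemma vword_ConsD:
  assumes "vword (i # w)"
  shows "vword w"
proof (cases "w = []")
  case False
  from assms obtain m where m: "1 \<le> m" "m \<le> Suc (length w)"
    "sorted_wrt (>) (take m (i # w))" "sorted_wrt (<) (drop (m - 1) (i # w))"
    by (auto simp: vword_def)
  have len: "1 \<le> length w"
    using False by (cases w) auto
  show ?thesis
  proof (cases "m = 1")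
    case True
    then have "sorted_wrt (<) w" using m(4) by simp
    moreover have "sorted_wrt (>) (take 1 w)" by (cases w) auto
    ultimately show ?thesis
      using len unfolding vword_def by (intro disjI2 bexI[of _ 1]) auto
  next
    case False
    then obtain k where k: "m = Suc (Suc k)"
      using m(1) by (metis One_nat_def Suc_le_D not0_implies_Suc)
    show ?thesis
      using m k unfolding vword_def by (intro disjI2 bexI[of _ "Suc k"]) auto
  qed
qed simp

section \<open>The discrete V-monotone Fock space\<close>

text \<open>The complex Hilbert space with orthonormal basis indexed by the V-words, realised as
  the square-summable families on the V-words; families are represented by functions on all
  words that vanish off the V-words.\<close>

typedef fock =
  "{f :: nat list \<Rightarrow> complex. (\<forall>w. \<not> vword w \<longrightarrow> f w = 0) \<and> (\<lambda>w. (cmod (f w))\<^sup>2) summable_on UNIV}"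
  morphisms coeff Abs_fock
  by (rule exI[of _ "\<lambda>_. 0"]) simp

setup_lifting type_definition_fock

lemma coeff_not_vword: "\<not> vword w \<Longrightarrow> coeff x w = 0"
  using coeff[of x] by blast

lemma coeff_summable: "(\<lambda>w. (cmod (coeff x w))\<^sup>2) summable_on A"
proof -
  have "(\<lambda>w. (cmod (coeff x w))\<^sup>2) summable_on UNIV"
    using coeff[of x] by blast
  then show ?thesis by (rule summable_on_subset_banach) simp
qed

lemma fock_eqI: "(\<And>w. coeff x w = coeff y w) \<Longrightarrow> x = y"
  by (metis coeff_inject ext)

lemma square_summable_add:
  fixes f g :: "nat list \<Rightarrow> complex"
  assumes "(\<lambda>w. (cmod (f w))\<^sup>2) summable_on A" "(\<lambda>w. (cmod (g w))\<^sup>2) summable_on A"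
  shows "(\<lambda>w. (cmod (f w + g w))\<^sup>2) summable_on A"
proof (rule summable_on_comparison_test)
  show "(\<lambda>w. 2 * (cmod (f w))\<^sup>2 + 2 * (cmod (g w))\<^sup>2) summable_on A"
    by (intro summable_on_add summable_on_cmult_right assms)
  fix w
  have "(cmod (f w + g w))\<^sup>2 \<le> (cmod (f w) + cmod (g w))\<^sup>2"
    by (intro power_mono norm_triangle_ineq) simp
  also have "\<dots> \<le> 2 * (cmod (f w))\<^sup>2 + 2 * (cmod (g w))\<^sup>2"
    using sum_squares_bound[of "cmod (f w)" "cmod (g w)"] by (simp add: power2_sum)
  finally show "(cmod (f w + g w))\<^sup>2 \<le> 2 * (cmod (f w))\<^sup>2 + 2 * (cmod (g w))\<^sup>2" .
qed simp

lemma square_summable_scale: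
  fixes f :: "nat list \<Rightarrow> complex"
  assumes "(\<lambda>w. (cmod (f w))\<^sup>2) summable_on A"
  shows "(\<lambda>w. (cmod (c * f w))\<^sup>2) summable_on A"
  using summable_on_cmult_right[OF assms, of "(cmod c)\<^sup>2"]
  by (simp add: norm_mult power_mult_distrib)

lift_definition scaleC :: "complex \<Rightarrow> fock \<Rightarrow> fock" is "\<lambda>c f w. c * f w"
  using square_summable_scale by auto

instantiation fock :: real_vector
begin

lift_definition zero_fock :: fock is "\<lambda>_. 0"
  by simp

lift_definition plus_fock :: "fock \<Rightarrow> fock \<Rightarrow> fock" is "\<lambda>f g w. f w + g w"
  using square_summable_add by auto

lift_definition uminus_fock :: "fock \<Rightarrow> fock" is "\<lambda>f w. - f w"
  by simp

definition minus_fock :: "fock \<Rightarrow> fock \<Rightarrow> fock" where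
  "minus_fock x y = x + - y"

definition scaleR_fock :: "real \<Rightarrow> fock \<Rightarrow> fock" where
  "scaleR_fock r = scaleC (of_real r)"

instance
  by standard
    (auto intro!: fock_eqI simp: minus_fock_def scaleR_fock_def algebra_simps
      zero_fock.rep_eq plus_fock.rep_eq uminus_fock.rep_eq scaleC.rep_eq)

end

lemma coeff_zero [simp]: "coeff 0 w = 0"
  by (simp add: zero_fock.rep_eq)

lemma coeff_add [simp]: "coeff (x + y) w = coeff x w + coeff y w"
  by (simp add: plus_fock.rep_eq)

lemma coeff_uminus [simp]: "coeff (- x) w = - coeff x w"
  by (simp add: uminus_fock.rep_eq)

lemma coeff_diff [simp]: "coeff (x - y) w = coeff x w - coeff y w"
  unfolding minus_fock_def coeff_add coeff_uminus by simp

lemma coeff_scaleC [simp]: "coeff (scaleC c x) w = c * coeff x w"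
  by (simp add: scaleC.rep_eq)

lemma coeff_scaleR [simp]: "coeff (r *\<^sub>R x) w = of_real r * coeff x w"
  by (simp add: scaleR_fock_def)

lemma coeff_sum: "coeff (\<Sum>i\<in>I. f i) w = (\<Sum>i\<in>I. coeff (f i) w)"
  by (induction I rule: infinite_finite_induct) auto

interpretation fock: vector_space scaleC
  by standard (auto intro!: fock_eqI simp: algebra_simps)

text \<open>The inner product is linear in the first argument and conjugate-linear in the second.\<close>

definition cinner :: "fock \<Rightarrow> fock \<Rightarrow> complex" where
  "cinner x y = (\<Sum>\<^sub>\<infinity>w. coeff x w * cnj (coeff y w))"

lemma cinner_summable: "(\<lambda>w. coeff x w * cnj (coeff y w)) summable_on A"
proof (rule abs_summable_summable, rule Infinite_Sum.abs_summable_on_comparison_test')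
  show "(\<lambda>w. (cmod (coeff x w))\<^sup>2 + (cmod (coeff y w))\<^sup>2) summable_on A"
    by (intro summable_on_add coeff_summable)
  fix w
  have "2 * (cmod (coeff x w) * cmod (coeff y w)) \<le> (cmod (coeff x w))\<^sup>2 + (cmod (coeff y w))\<^sup>2"
    using sum_squares_bound[of "cmod (coeff x w)" "cmod (coeff y w)"] by simp
  moreover have "0 \<le> cmod (coeff x w) * cmod (coeff y w)" by simp
  ultimately show "cmod (coeff x w * cnj (coeff y w)) \<le> (cmod (coeff x w))\<^sup>2 + (cmod (coeff y w))\<^sup>2"
    unfolding norm_mult complex_mod_cnj by linarith
qed

lemma cinner_add_left: "cinner (x + y) z = cinner x z + cinner y z"
  unfolding cinner_def coeff_add distrib_right by (intro infsum_add cinner_summable)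

lemma cinner_scaleC_left: "cinner (scaleC c x) y = c * cinner x y"
  unfolding cinner_def by (simp add: infsum_cmult_right' mult.assoc)

lemma cinner_commute: "cinner x y = cnj (cinner y x)"
  unfolding cinner_def by (simp add: mult.commute flip: infsum_cnj)

lemma cinner_self: "cinner x x = of_real (\<Sum>\<^sub>\<infinity>w. (cmod (coeff x w))\<^sup>2)"
proof -
  have "((\<lambda>w. complex_of_real ((cmod (coeff x w))\<^sup>2)) has_sum
      of_real (\<Sum>\<^sub>\<infinity>w. (cmod (coeff x w))\<^sup>2)) UNIV"
    unfolding has_sum_of_real_iff by (rule has_sum_infsum[OF coeff_summable])
  then show ?thesis
    unfolding cinner_def complex_norm_square by (rule infsumI)
qed

instantiation fock :: real_inner
begin

definition inner_fock :: "fock \<Rightarrow> fock \<Rightarrow> real" where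
  "inner_fock x y = Re (cinner x y)"

definition norm_fock :: "fock \<Rightarrow> real" where
  "norm_fock x = sqrt (Re (cinner x x))"

definition dist_fock :: "fock \<Rightarrow> fock \<Rightarrow> real" where
  "dist_fock x y = norm (x - y)"

definition sgn_fock :: "fock \<Rightarrow> fock" where
  "sgn_fock x = x /\<^sub>R norm x"

definition uniformity_fock :: "(fock \<times> fock) filter" where
  "uniformity_fock = (INF e\<in>{0<..}. principal {(x, y). dist x y < e})"

definition open_fock :: "fock set \<Rightarrow> bool" where
  "open_fock U = (\<forall>x\<in>U. eventually (\<lambda>(x', y). x' = x \<longrightarrow> y \<in> U) uniformity)"

instance
proof
  fix x y z :: fock and r :: real and U :: "fock set"
  show "dist x y = norm (x - y)" by (fact dist_fock_def)
  show "sgn x = x /\<^sub>R norm x" by (fact sgn_fock_def)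
  show "uniformity = (INF e\<in>{0<..}. principal {(x, y :: fock). dist x y < e})"
    by (fact uniformity_fock_def)
  show "open U = (\<forall>x\<in>U. eventually (\<lambda>(x', y). x' = x \<longrightarrow> y \<in> U) uniformity)"
    by (fact open_fock_def)
  show "inner x y = inner y x"
    unfolding inner_fock_def by (subst cinner_commute) simp
  show "inner (x + y) z = inner x z + inner y z"
    by (simp add: inner_fock_def cinner_add_left)
  show "inner (r *\<^sub>R x) y = r * inner x y"
    by (simp add: inner_fock_def scaleR_fock_def cinner_scaleC_left)
  show "0 \<le> inner x x"
    by (simp add: inner_fock_def cinner_self infsum_nonneg)
  show "inner x x = 0 \<longleftrightarrow> x = 0"
  proof
    assume "inner x x = 0"
    then have "(\<Sum>\<^sub>\<infinity>w. (cmod (coeff x w))\<^sup>2) = 0"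
      by (simp add: inner_fock_def cinner_self)
    then have "(cmod (coeff x w))\<^sup>2 = 0" for w
      using nonneg_infsum_le_0D[OF _ coeff_summable[of x UNIV], of w] by simp
    then show "x = 0" by (intro fock_eqI) simp
  qed (simp add: inner_fock_def cinner_def)
  show "norm x = sqrt (inner x x)"
    by (simp add: norm_fock_def inner_fock_def)
qed

end

lemma norm_fock_square: "(norm (x :: fock))\<^sup>2 = (\<Sum>\<^sub>\<infinity>w. (cmod (coeff x w))\<^sup>2)"
  by (simp add: norm_fock_def cinner_self infsum_nonneg)

lemma norm_coeff_le: "cmod (coeff x w) \<le> norm x"
proof -
  have "(cmod (coeff x w))\<^sup>2 \<le> (norm x)\<^sup>2"
    using finite_sum_le_infsum[OF coeff_summable, of "{w}" UNIV x]
    by (simp add: norm_fock_square)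
  then show ?thesis
    by (rule power2_le_imp_le) simp
qed

lemma norm_scaleC: "norm (scaleC c x) = cmod c * norm x"
proof -
  have "(norm (scaleC c x))\<^sup>2 = (cmod c * norm x)\<^sup>2"
    by (simp add: norm_fock_square norm_mult power_mult_distrib infsum_cmult_right')
  then show ?thesis by simp
qed

instance fock :: banach
proof
  fix X :: "nat \<Rightarrow> fock"
  assume X: "Cauchy X"
  define f where "f w = lim (\<lambda>n. coeff (X n) w)" for w
  have "Cauchy (\<lambda>n. coeff (X n) w)" for w
  proof (rule metric_CauchyI)
    fix e :: real assume "0 < e"
    then obtain M where M: "\<And>m n. m \<ge> M \<Longrightarrow> n \<ge> M \<Longrightarrow> dist (X m) (X n) < e"
      using metric_CauchyD[OF X] by blast
    have "dist (coeff (X m) w) (coeff (X n) w) < e" if "m \<ge> M" "n \<ge> M" for m n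
      using M[OF that] norm_coeff_le[of "X m - X n" w] by (simp add: dist_norm)
    then show "\<exists>M. \<forall>m\<ge>M. \<forall>n\<ge>M. dist (coeff (X m) w) (coeff (X n) w) < e" by blast
  qed
  then have lim: "(\<lambda>n. coeff (X n) w) \<longlonglongrightarrow> f w" for w
    unfolding f_def by (simp add: Cauchy_convergent_iff convergent_LIMSEQ_iff)
  have fin: "\<exists>M. \<forall>n\<ge>M. \<forall>F. finite F \<longrightarrow> (\<Sum>w\<in>F. (cmod (f w - coeff (X n) w))\<^sup>2) \<le> e\<^sup>2"
    if e: "0 < e" for e :: real
  proof -
    obtain M where M: "\<And>m n. m \<ge> M \<Longrightarrow> n \<ge> M \<Longrightarrow> dist (X m) (X n) < e"
      using metric_CauchyD[OF X e] by blast
    have "(\<Sum>w\<in>F. (cmod (f w - coeff (X n) w))\<^sup>2) \<le> e\<^sup>2" if n: "n \<ge> M" and F: "finite F" for n F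
    proof (rule LIMSEQ_le_const2)
      show "(\<lambda>m. \<Sum>w\<in>F. (cmod (coeff (X m) w - coeff (X n) w))\<^sup>2)
              \<longlonglongrightarrow> (\<Sum>w\<in>F. (cmod (f w - coeff (X n) w))\<^sup>2)"
        by (intro tendsto_intros lim)
      have "(\<Sum>w\<in>F. (cmod (coeff (X m) w - coeff (X n) w))\<^sup>2) \<le> e\<^sup>2" if m: "m \<ge> M" for m
      proof -
        have "(\<Sum>w\<in>F. (cmod (coeff (X m) w - coeff (X n) w))\<^sup>2) \<le> (norm (X m - X n))\<^sup>2"
          using finite_sum_le_infsum[OF coeff_summable F, of UNIV "X m - X n"]
          by (simp add: norm_fock_square)
        also have "\<dots> \<le> e\<^sup>2"
          using M[OF m n] by (intro power_mono) (auto simp: dist_norm)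
        finally show ?thesis .
      qed
      then show "\<exists>N. \<forall>m\<ge>N. (\<Sum>w\<in>F. (cmod (coeff (X m) w - coeff (X n) w))\<^sup>2) \<le> e\<^sup>2"
        by blast
    qed
    then show ?thesis by blast
  qed
  have supp: "f w = 0" if "\<not> vword w" for w
    using lim[of w] that by (simp add: coeff_not_vword LIMSEQ_const_iff)
  have diff_summable: "(\<lambda>w. (cmod (f w - coeff (X n) w))\<^sup>2) summable_on UNIV"
    if "\<forall>F. finite F \<longrightarrow> (\<Sum>w\<in>F. (cmod (f w - coeff (X n) w))\<^sup>2) \<le> e\<^sup>2" for n and e :: real
    by (rule nonneg_bdd_above_summable_on) (use that in \<open>auto intro!: bdd_aboveI2\<close>)
  obtain M1 where "\<forall>F. finite F \<longrightarrow> (\<Sum>w\<in>F. (cmod (f w - coeff (X M1) w))\<^sup>2) \<le> 1\<^sup>2"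
    using fin[of 1] by auto
  then have "(\<lambda>w. (cmod ((f w - coeff (X M1) w) + coeff (X M1) w))\<^sup>2) summable_on UNIV"
    by (intro square_summable_add diff_summable coeff_summable)
  then have sq: "(\<lambda>w. (cmod (f w))\<^sup>2) summable_on UNIV" by simp
  define x where "x = Abs_fock f"
  have x: "coeff x w = f w" for w
    unfolding x_def using supp sq by (subst Abs_fock_inverse) auto
  have "X \<longlonglongrightarrow> x"
  proof (rule metric_LIMSEQ_I)
    fix e :: real assume e: "0 < e"
    then obtain M where
      M: "\<And>n F. n \<ge> M \<Longrightarrow> finite F \<Longrightarrow> (\<Sum>w\<in>F. (cmod (f w - coeff (X n) w))\<^sup>2) \<le> (e / 2)\<^sup>2"
      using fin[of "e / 2"] by auto
    have "dist (X n) x < e" if n: "n \<ge> M" for n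
    proof -
      have "(norm (x - X n))\<^sup>2 \<le> (e / 2)\<^sup>2"
        unfolding norm_fock_square
        by (rule infsum_le_finite_sums[OF coeff_summable]) (use M[OF n] x in simp)
      then have "norm (x - X n) \<le> e / 2"
        using e by (intro power2_le_imp_le[of "norm (x - X n)" "e / 2"]) auto
      then show ?thesis using e by (simp add: dist_norm norm_minus_commute)
    qed
    then show "\<exists>no. \<forall>n\<ge>no. dist (X n) x < e" by blast
  qed
  then show "convergent X" by (rule convergentI)
qed

lift_definition basis_vec :: "nat list \<Rightarrow> fock" is
  "\<lambda>w v. if v = w \<and> vword w then 1 else 0"
proof -
  fix w :: "nat list"
  have eq: "(\<lambda>v. (cmod (if v = w \<and> vword w then 1 else 0))\<^sup>2) summable_on UNIV \<longleftrightarrow>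
      (\<lambda>v. (cmod (if v = w \<and> vword w then 1 else 0))\<^sup>2) summable_on {w}"
    by (rule summable_on_cong_neutral) auto
  have sq: "(\<lambda>v. (cmod (if v = w \<and> vword w then 1 else 0))\<^sup>2) summable_on UNIV"
    unfolding eq by (rule summable_on_finite) simp
  show "(\<forall>v. \<not> vword v \<longrightarrow> (if v = w \<and> vword w then 1 else (0::complex)) = 0) \<and>
      (\<lambda>v. (cmod (if v = w \<and> vword w then 1 else 0))\<^sup>2) summable_on UNIV"
    using sq by (intro conjI) (simp, assumption)
qed

lemma coeff_basis_vec: "coeff (basis_vec w) v = (if v = w \<and> vword w then 1 else 0)"
  by (simp add: basis_vec.rep_eq)

lemma basis_vec_not_vword: "\<not> vword w \<Longrightarrow> basis_vec w = 0"
  by (rule fock_eqI) (simp add: coeff_basis_vec)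

lemma cinner_basis_vec_right: "cinner x (basis_vec w) = coeff x w"
proof -
  have "cinner x (basis_vec w) = (\<Sum>\<^sub>\<infinity>v\<in>{w}. coeff x v * cnj (coeff (basis_vec w) v))"
    unfolding cinner_def
    by (rule infsum_cong_neutral) (auto simp: coeff_basis_vec)
  then show ?thesis
    by (auto simp: coeff_basis_vec coeff_not_vword)
qed

lemma basis_vec_orthonormal:
  "vword v \<Longrightarrow> vword w \<Longrightarrow> cinner (basis_vec v) (basis_vec w) = (if v = w then 1 else 0)"
  by (auto simp: cinner_basis_vec_right coeff_basis_vec)

lemma has_sum_dist_iff:
  fixes f :: "'a \<Rightarrow> 'b :: {comm_monoid_add, metric_space}"
  shows "(f has_sum x) UNIV \<longleftrightarrow>
    (\<forall>e>0. \<exists>F. finite F \<and> (\<forall>G. finite G \<and> F \<subseteq> G \<longrightarrow> dist (sum f G) x < e))"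
  by (simp add: has_sum_def tendsto_iff eventually_finite_subsets_at_top)

lemma basis_expansion: "((\<lambda>w. scaleC (coeff x w) (basis_vec w)) has_sum x) UNIV"
  unfolding has_sum_dist_iff
proof (intro allI impI)
  fix e :: real assume e: "0 < e"
  let ?f = "\<lambda>w. (cmod (coeff x w))\<^sup>2"
  have "(?f has_sum (norm x)\<^sup>2) UNIV"
    unfolding norm_fock_square by (rule has_sum_infsum[OF coeff_summable])
  then have "\<exists>F. finite F \<and>
      (\<forall>G. finite G \<and> F \<subseteq> G \<longrightarrow> dist (sum ?f G) ((norm x)\<^sup>2) < e\<^sup>2)"
    using e unfolding has_sum_dist_iff by (elim allE[of _ "e\<^sup>2"]) simp
  then obtain F where F: "finite F"
      "\<forall>G. finite G \<and> F \<subseteq> G \<longrightarrow> dist (sum ?f G) ((norm x)\<^sup>2) < e\<^sup>2"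
    by (elim exE conjE)
  have "dist (\<Sum>w\<in>G. scaleC (coeff x w) (basis_vec w)) x < e" if G: "finite G" "F \<subseteq> G" for G
  proof -
    let ?y = "\<Sum>w\<in>G. scaleC (coeff x w) (basis_vec w)"
    have y: "coeff ?y v = (if v \<in> G then coeff x v else 0)" for v
    proof -
      have "coeff ?y v = (\<Sum>w\<in>G. if v = w then coeff x v else 0)"
        unfolding coeff_sum by (rule sum.cong) (auto simp: coeff_basis_vec coeff_not_vword)
      then show ?thesis using G by simp
    qed
    have "(norm (x - ?y))\<^sup>2 = (\<Sum>\<^sub>\<infinity>w\<in>- G. ?f w)"
      unfolding norm_fock_square by (rule infsum_cong_neutral) (auto simp: y)
    also have "\<dots> = (norm x)\<^sup>2 - sum ?f G"
      using infsum_Un_disjoint[of ?f G "- G"] coeff_summable G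
      by (simp add: norm_fock_square)
    also have "\<dots> < e\<^sup>2"
      using F(2)[rule_format, of G] G by (simp add: dist_real_def)
    finally have "norm (x - ?y) < e"
      using e by (intro power2_less_imp_less[of "norm (x - ?y)" e]) auto
    then show ?thesis by (simp add: dist_norm norm_minus_commute)
  qed
  then show "\<exists>F. finite F \<and> (\<forall>G. finite G \<and> F \<subseteq> G \<longrightarrow>
      dist (\<Sum>w\<in>G. scaleC (coeff x w) (basis_vec w)) x < e)"
    using F(1) by (intro exI[of _ F]) simp
qed

section \<open>Creation, annihilation and conservation operators\<close>

definition bounded_clinear :: "(fock \<Rightarrow> fock) \<Rightarrow> bool" where
  "bounded_clinear T \<longleftrightarrow> bounded_linear T \<and> (\<forall>c x. T (scaleC c x) = scaleC c (T x))"

lemma bounded_clinear_eqI: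
  assumes S: "bounded_clinear S" and T: "bounded_clinear T"
    and eq: "\<And>w. vword w \<Longrightarrow> S (basis_vec w) = T (basis_vec w)"
  shows "S = T"
proof
  fix x
  have eq': "S (basis_vec w) = T (basis_vec w)" for w
  proof (cases "vword w")
    case False
    then show ?thesis
      using S T by (simp add: bounded_clinear_def basis_vec_not_vword linear_0 bounded_linear.linear)
  qed (rule eq)
  have "((\<lambda>w. scaleC (coeff x w) (T (basis_vec w))) has_sum S x) UNIV"
    using has_sum_bounded_linear[OF _ basis_expansion, of S x] S eq'
    by (simp add: bounded_clinear_def)
  moreover have "((\<lambda>w. scaleC (coeff x w) (T (basis_vec w))) has_sum T x) UNIV"
    using has_sum_bounded_linear[OF _ basis_expansion, of T x] T
    by (simp add: bounded_clinear_def)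
  ultimately show "S x = T x" by (rule has_sum_unique)
qed

text \<open>The bounded operator determined by its values on the basis. The description denotes
  something only if such an operator exists; it is unique by \<open>bounded_clinear_eqI\<close>, and
  \<open>creation\<close>, \<open>annihilation\<close> and \<open>conservation\<close> are shown to exist below.\<close>

definition op_of_basis :: "(nat list \<Rightarrow> fock) \<Rightarrow> fock \<Rightarrow> fock" where
  "op_of_basis g = (THE T. bounded_clinear T \<and> (\<forall>w. vword w \<longrightarrow> T (basis_vec w) = g w))"

definition creation :: "nat \<Rightarrow> fock \<Rightarrow> fock" where
  "creation i = op_of_basis (\<lambda>w. basis_vec (i # w))"

definition annihilation :: "nat \<Rightarrow> fock \<Rightarrow> fock" where
  "annihilation i =
     op_of_basis (\<lambda>w. case w of [] \<Rightarrow> 0 | j # w\<^sub>0 \<Rightarrow> if i = j then basis_vec w\<^sub>0 else 0)"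

definition conservation :: "nat \<Rightarrow> fock \<Rightarrow> fock" where
  "conservation i =
     op_of_basis (\<lambda>w. case w of [] \<Rightarrow> 0 | j # w\<^sub>0 \<Rightarrow> if i = j then basis_vec w else 0)"

lemma op_of_basis_eqI:
  assumes "bounded_clinear T" "\<And>w. vword w \<Longrightarrow> T (basis_vec w) = g w"
  shows "op_of_basis g = T"
  unfolding op_of_basis_def
  by (rule the_equality) (use assms in \<open>auto intro!: bounded_clinear_eqI\<close>)

text \<open>Restricting to a set of words and relabelling injectively along \<open>h\<close> gives a contraction.\<close>

lemma relabel_contraction:
  fixes h :: "nat list \<Rightarrow> nat list" and Q :: "nat list \<Rightarrow> bool"
  assumes inj: "inj_on h (Collect Q)" and Qv: "\<And>w. Q w \<Longrightarrow> \<not> vword w \<Longrightarrow> \<not> vword (h w)"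
  obtains T where "bounded_clinear T"
    "\<And>x w. coeff (T x) w = (if Q w then coeff x (h w) else 0)"
proof -
  define f where "f x w = (if Q w then coeff x (h w) else 0)" for x w
  have eqf: "(cmod (f x w))\<^sup>2 = (if w \<in> Collect Q then ((\<lambda>w. (cmod (coeff x w))\<^sup>2) \<circ> h) w else 0)" for x w
    by (simp add: f_def)
  have sumQ: "((\<lambda>w. (cmod (coeff x w))\<^sup>2) \<circ> h) summable_on Collect Q" for x
    using summable_on_reindex[OF inj, of "\<lambda>w. (cmod (coeff x w))\<^sup>2"] coeff_summable by blast
  have sum: "(\<lambda>w. (cmod (f x w))\<^sup>2) summable_on UNIV" for x
  proof -
    have "(\<lambda>w. (cmod (f x w))\<^sup>2) summable_on UNIV \<longleftrightarrow>
        ((\<lambda>w. (cmod (coeff x w))\<^sup>2) \<circ> h) summable_on Collect Q"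
      by (rule summable_on_cong_neutral) (auto simp: eqf)
    with sumQ show ?thesis by blast
  qed
  define T where "T x = Abs_fock (f x)" for x
  have cT: "coeff (T x) w = f x w" for x w
    unfolding T_def using sum coeff_not_vword Qv by (subst Abs_fock_inverse) (auto simp: f_def)
  have le: "norm (T x) \<le> norm x" for x
  proof -
    have "(norm (T x))\<^sup>2 = infsum ((\<lambda>w. (cmod (coeff x w))\<^sup>2) \<circ> h) (Collect Q)"
      unfolding norm_fock_square cT by (rule infsum_cong_neutral) (auto simp: eqf)
    also have "\<dots> = (\<Sum>\<^sub>\<infinity>w\<in>h ` Collect Q. (cmod (coeff x w))\<^sup>2)"
      by (rule infsum_reindex[OF inj, symmetric])
    also have "\<dots> \<le> (norm x)\<^sup>2"
      unfolding norm_fock_square by (intro infsum_mono2 coeff_summable) auto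
    finally show ?thesis by (rule power2_le_imp_le) simp
  qed
  have "bounded_linear T"
    by (rule bounded_linear_intro[where K = 1])
      (use le in \<open>auto intro!: fock_eqI simp: cT f_def\<close>)
  moreover have "T (scaleC c x) = scaleC c (T x)" for c x
    by (auto intro!: fock_eqI simp: cT f_def)
  ultimately show ?thesis
    using that[of T] cT by (simp add: bounded_clinear_def f_def)
qed

lemma creation_ex:
  "\<exists>T. bounded_clinear T \<and> (\<forall>w. vword w \<longrightarrow> T (basis_vec w) = basis_vec (i # w))"
proof -
  let ?Q = "\<lambda>w. w \<noteq> [] \<and> hd w = i \<and> vword w"
  have "inj_on tl (Collect ?Q)"
    by (auto simp: inj_on_def intro: list.expand)
  then obtain T where T: "bounded_clinear T"
    "\<And>x w. coeff (T x) w = (if ?Q w then coeff x (tl w) else 0)"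
    by (rule relabel_contraction[of tl ?Q]) auto
  have "T (basis_vec w) = basis_vec (i # w)" if "vword w" for w
    using that by (intro fock_eqI) (auto simp: T(2) coeff_basis_vec)
  with T(1) show ?thesis by blast
qed

lemma annihilation_ex:
  "\<exists>T. bounded_clinear T \<and> (\<forall>w. vword w \<longrightarrow>
     T (basis_vec w) = (case w of [] \<Rightarrow> 0 | j # w\<^sub>0 \<Rightarrow> if i = j then basis_vec w\<^sub>0 else 0))"
proof -
  obtain T where T: "bounded_clinear T"
    "\<And>x w. coeff (T x) w = (if True then coeff x (i # w) else 0)"
    by (rule relabel_contraction[of "(#) i" "\<lambda>_. True"]) (auto dest: vword_ConsD)
  have "T (basis_vec w) = (case w of [] \<Rightarrow> 0 | j # w\<^sub>0 \<Rightarrow> if i = j then basis_vec w\<^sub>0 else 0)"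
    if "vword w" for w
    using that vword_ConsD
    by (intro fock_eqI) (auto simp: T(2) coeff_basis_vec split: list.split)
  with T(1) show ?thesis by blast
qed

lemma conservation_ex:
  "\<exists>T. bounded_clinear T \<and> (\<forall>w. vword w \<longrightarrow>
     T (basis_vec w) = (case w of [] \<Rightarrow> 0 | j # w\<^sub>0 \<Rightarrow> if i = j then basis_vec w else 0))"
proof -
  let ?Q = "\<lambda>w. w \<noteq> [] \<and> hd w = i"
  obtain T where T: "bounded_clinear T"
    "\<And>x w. coeff (T x) w = (if ?Q w then coeff x (id w) else 0)"
    by (rule relabel_contraction[of id ?Q]) auto
  have "T (basis_vec w) = (case w of [] \<Rightarrow> 0 | j # w\<^sub>0 \<Rightarrow> if i = j then basis_vec w else 0)"
    if "vword w" for w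
    using that by (intro fock_eqI) (auto simp: T(2) coeff_basis_vec split: list.split)
  with T(1) show ?thesis by blast
qed

lemma op_of_basis_works:
  assumes "\<exists>T. bounded_clinear T \<and> (\<forall>w. vword w \<longrightarrow> T (basis_vec w) = g w)"
  shows "bounded_clinear (op_of_basis g)" "vword w \<Longrightarrow> op_of_basis g (basis_vec w) = g w"
  using assms op_of_basis_eqI by metis+

lemma bounded_clinear_creation: "bounded_clinear (creation i)"
  unfolding creation_def by (rule op_of_basis_works[OF creation_ex])

lemma creation_basis_vec: "vword w \<Longrightarrow> creation i (basis_vec w) = basis_vec (i # w)"
  unfolding creation_def by (rule op_of_basis_works[OF creation_ex])

lemma bounded_clinear_annihilation: "bounded_clinear (annihilation i)"
  unfolding annihilation_def by (rule op_of_basis_works[OF annihilation_ex])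

lemma annihilation_basis_vec:
  "annihilation i (basis_vec []) = 0"
  "vword (j # w) \<Longrightarrow> annihilation i (basis_vec (j # w)) = (if i = j then basis_vec w else 0)"
  unfolding annihilation_def by (simp_all add: op_of_basis_works[OF annihilation_ex])

lemma bounded_clinear_conservation: "bounded_clinear (conservation i)"
  unfolding conservation_def by (rule op_of_basis_works[OF conservation_ex])

lemma conservation_basis_vec:
  "conservation i (basis_vec []) = 0"
  "vword (j # w) \<Longrightarrow> conservation i (basis_vec (j # w)) = (if i = j then basis_vec (j # w) else 0)"
  unfolding conservation_def by (simp_all add: op_of_basis_works[OF conservation_ex])

definition vacuum :: fock where
  "vacuum = basis_vec []"

definition vacuum_state :: "(fock \<Rightarrow> fock) \<Rightarrow> complex" where
  "vacuum_state b = cinner (b vacuum) vacuum"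

definition S_op :: "nat \<Rightarrow> real \<Rightarrow> fock \<Rightarrow> fock" where
  "S_op N lam x =
     (\<Sum>i = 1..N. (creation i x + annihilation i x) /\<^sub>R sqrt (real N) + lam *\<^sub>R conservation i x)"

definition moment :: "nat \<Rightarrow> real \<Rightarrow> nat \<Rightarrow> complex" where
  "moment n lam N = vacuum_state (S_op N lam ^^ n)"

section \<open>V-monotonically labeled noncrossing partitions\<close>

definition noncrossing :: "nat set set \<Rightarrow> bool" where
  "noncrossing \<pi> \<longleftrightarrow> (\<forall>B\<in>\<pi>. \<forall>B'\<in>\<pi>. B \<noteq> B' \<longrightarrow>
     \<not> (\<exists>a\<in>B. \<exists>b\<in>B'. \<exists>c\<in>B. \<exists>d\<in>B'. a < b \<and> b < c \<and> c < d))"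

definition NC2 :: "nat \<Rightarrow> nat set set set" where
  "NC2 n = {\<pi>. partition_on {1..n} \<pi> \<and> noncrossing \<pi> \<and> (\<forall>B\<in>\<pi>. 2 \<le> card B)}"

text \<open>\<open>nested B' B\<close> is \<open>B' \<prec> B\<close>: the block \<open>B\<close> lies strictly between two consecutive elements
  of \<open>B'\<close>, so the outer block is the smaller one.\<close>

definition nested :: "nat set \<Rightarrow> nat set \<Rightarrow> bool" where
  "nested B' B \<longleftrightarrow> (let l = sorted_list_of_set B' in
     \<exists>q\<in>{1..<length l}. l ! (q - 1) < Min B \<and> Max B < l ! q)"

definition V_monotone :: "nat set set \<Rightarrow> (nat set \<Rightarrow> nat) \<Rightarrow> bool" where
  "V_monotone \<pi> L \<longleftrightarrow>
     (\<forall>Bs. sorted_wrt nested Bs \<and> pred_on.maxchain \<pi> nested (set Bs) \<longrightarrow> vword (rev (map L Bs)))"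

text \<open>Labelings are taken extensional (\<open>undefined\<close> off the blocks), so that each function on the
  blocks is counted exactly once.\<close>

definition LV2 :: "nat \<Rightarrow> nat \<Rightarrow> nat \<Rightarrow> (nat set set \<times> (nat set \<Rightarrow> nat)) set" where
  "LV2 N n k = {(\<pi>, L). \<pi> \<in> NC2 n \<and> card \<pi> = k \<and> L \<in> \<pi> \<rightarrow>\<^sub>E {1..N} \<and> V_monotone \<pi> L}"

lemma finite_LV2: "finite (LV2 N n k)"
proof (rule finite_subset)
  show "LV2 N n k \<subseteq> Sigma (Pow (Pow {1..n})) (\<lambda>\<pi>. \<pi> \<rightarrow>\<^sub>E {1..N})"
    by (auto simp: LV2_def NC2_def partition_on_def)
  show "finite (Sigma (Pow (Pow {1..n})) (\<lambda>\<pi>. \<pi> \<rightarrow>\<^sub>E {1..N}))"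
    by (intro finite_SigmaI finite_PiE) (auto intro: finite_subset)
qed

lemma LV2_0_0: "LV2 N 0 0 = {({}, \<lambda>_. undefined)}"
proof -
  have NC: "NC2 0 = {{}}"
    by (auto simp: NC2_def partition_on_empty noncrossing_def)
  have "V_monotone {} L" for L
    by (auto simp: V_monotone_def pred_on.maxchain_def pred_on.chain_def)
  then show ?thesis
    by (auto simp: LV2_def NC)
qed

end

theory Submission
  imports Defs
begin

text \<open>Expanding \<open>S_op N lam ^^ n\<close> applied to the vacuum, one summand is chosen at each of the
  times \<open>1, \<dots>, n\<close>. A summand turns a basis vector \<open>e\<^sub>w\<close> into another one or into zero: it pushes a
  label onto the word \<open>w\<close>, keeps \<open>w\<close> if it is not empty, or pops its first letter. The moment is
  thus a weighted count of the closed paths, the sequences of such moves that lead from the empty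
  word back to the empty word through V-words (\<open>moment_eq_sum_paths\<close>). A closed path with \<open>k\<close>
  pushes has \<open>k\<close> pops and \<open>n - 2 * k\<close> stays, so its weight is \<open>lam ^ (n - 2 * k) / N ^ k\<close>
  (\<open>moment_eq_count_paths\<close>), and it remains to see that these paths are equinumerous with
  \<open>LV2 N n k\<close> (\<open>bij_path_of\<close>).

  A path is read as the history of a stack of open blocks: a push opens a block and records its
  label, a stay adds a middle element to the block on top of the stack, a pop adds the last
  element to it and closes it. Every block thereby has at least two elements, and the last-in
  first-out discipline is exactly the noncrossing condition. Conversely, time \<open>t\<close> is a push, pop
  or stay according to whether \<open>t\<close> is the minimum, the maximum or a middle element of its block.
  In this dictionary the word at time \<open>t\<close> lists the labels of the blocks open at \<open>t\<close>, innermost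
  first (\<open>stack_path_of\<close>).

  Finally the two V-conditions agree (\<open>V_monotone_iff\<close>). The blocks open at time \<open>Min B\<close> are \<open>B\<close>
  and the blocks around it. They form an initial segment of every maximal chain through \<open>B\<close>, and
  all of the chain if \<open>B\<close> is its innermost block, while V-words are closed under removing first
  letters.\<close>

section \<open>Paths and the vacuum moments\<close>

datatype step = Push nat | Stay | Pop

text \<open>A step acts on the word that indexes the current basis vector; the first letter is the top of
  the stack.\<close>

fun apply_step :: "step \<Rightarrow> nat list \<Rightarrow> nat list" where
  "apply_step (Push i) w = i # w"
| "apply_step Stay w = w"
| "apply_step Pop w = tl w"

definition moves :: "nat \<Rightarrow> nat list \<Rightarrow> step set" where
  "moves N w = Push ` {i \<in> {1..N}. vword (i # w)} \<union> (if w = [] then {} else {Stay, Pop})"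

text \<open>Paths are listed with the latest step first, as in a product of operators. Hence the suffixes
  of a path are its earlier stages, and the time at which a step is made is the length of the
  suffix that starts with it.\<close>

primrec stack :: "step list \<Rightarrow> nat list" where
  "stack [] = []"
| "stack (s # p) = apply_step s (stack p)"

primrec paths :: "nat \<Rightarrow> nat \<Rightarrow> step list set" where
  "paths N 0 = {[]}"
| "paths N (Suc n) = (\<lambda>(p, s). s # p) ` Sigma (paths N n) (\<lambda>p. moves N (stack p))"

fun step_weight :: "real \<Rightarrow> real \<Rightarrow> step \<Rightarrow> real" where
  "step_weight c lam (Push i) = c"
| "step_weight c lam Stay = lam"
| "step_weight c lam Pop = c"

definition weight :: "real \<Rightarrow> real \<Rightarrow> step list \<Rightarrow> real" where
  "weight c lam p = prod_list (map (step_weight c lam) p)"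

lemma finite_moves: "finite (moves N w)"
  by (simp add: moves_def)

lemma finite_paths: "finite (paths N n)"
  by (induction n) (auto intro!: finite_imageI finite_SigmaI finite_moves)

lemma paths_length: "p \<in> paths N n \<Longrightarrow> length p = n"
  by (induction n arbitrary: p) auto

lemma apply_step_moves:
  assumes "s \<in> moves N w" "vword w" "set w \<subseteq> {1..N}"
  shows "vword (apply_step s w)" "set (apply_step s w) \<subseteq> {1..N}"
proof -
  have "vword (tl w)"
    using assms(2) by (cases w) (auto dest: vword_ConsD)
  moreover have "set (tl w) \<subseteq> set w" by (cases w) auto
  ultimately show "vword (apply_step s w)" "set (apply_step s w) \<subseteq> {1..N}"
    using assms by (auto simp: moves_def split: if_splits)
qed

lemma paths_stack:
  "p \<in> paths N n \<Longrightarrow> vword (stack p) \<and> set (stack p) \<subseteq> {1..N}"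
proof (induction n arbitrary: p)
  case (Suc n)
  then obtain q s where "p = s # q" "q \<in> paths N n" "s \<in> moves N (stack q)" by auto
  with Suc.IH[of q] apply_step_moves[of s N "stack q"] show ?case by simp
qed simp

lemma bounded_linear_S_op: "bounded_linear (S_op N lam)"
proof -
  have "bounded_linear (creation i)" "bounded_linear (annihilation i)"
    "bounded_linear (conservation i)" for i
    using bounded_clinear_creation bounded_clinear_annihilation bounded_clinear_conservation
    by (auto simp: bounded_clinear_def)
  then show ?thesis
    unfolding S_op_def[abs_def]
    by (intro bounded_linear_sum bounded_linear_add bounded_linear_compose[OF bounded_linear_scaleR_right])
qed

text \<open>For each kind of operator at most the labels that lead to a V-word survive: \<open>basis_vec\<close> vanishes
  off the V-words, which removes the forbidden creations, and in the sums of annihilations and of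
  conservations only the summand with the first letter of \<open>w\<close> remains. It is there because that
  letter lies in \<open>{1..N}\<close>.\<close>

lemma S_op_basis_vec:
  assumes w: "vword w" "set w \<subseteq> {1..N}"
  shows "S_op N lam (basis_vec w) =
    (\<Sum>s\<in>moves N w. step_weight (1 / sqrt (real N)) lam s *\<^sub>R basis_vec (apply_step s w))"
proof -
  let ?c = "1 / sqrt (real N)"
  let ?A = "{i \<in> {1..N}. vword (i # w)}"
  let ?stay = "if w = [] then {} else {Stay, Pop}"
  let ?f = "\<lambda>s. step_weight ?c lam s *\<^sub>R basis_vec (apply_step s w)"
  have cre: "(\<Sum>i = 1..N. ?c *\<^sub>R creation i (basis_vec w)) = sum ?f (Push ` ?A)"
  proof -
    have "(\<Sum>i = 1..N. ?c *\<^sub>R creation i (basis_vec w)) = (\<Sum>i = 1..N. ?c *\<^sub>R basis_vec (i # w))"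
      using w by (simp add: creation_basis_vec)
    also have "\<dots> = (\<Sum>i\<in>?A. ?c *\<^sub>R basis_vec (i # w))"
      by (rule sum.mono_neutral_right) (auto simp: basis_vec_not_vword)
    also have "\<dots> = sum ?f (Push ` ?A)"
      by (simp add: sum.reindex inj_on_def)
    finally show ?thesis .
  qed
  have rest: "(\<Sum>i = 1..N. ?c *\<^sub>R annihilation i (basis_vec w))
      + (\<Sum>i = 1..N. lam *\<^sub>R conservation i (basis_vec w)) = sum ?f ?stay"
  proof (cases w)
    case Nil
    then show ?thesis by (simp add: annihilation_basis_vec conservation_basis_vec)
  next
    case (Cons j v)
    have "(\<Sum>i = 1..N. ?c *\<^sub>R annihilation i (basis_vec w)) =
        (\<Sum>i = 1..N. if i = j then ?c *\<^sub>R basis_vec v else 0)"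
      using w Cons by (intro sum.cong) (auto simp: annihilation_basis_vec)
    moreover have "(\<Sum>i = 1..N. lam *\<^sub>R conservation i (basis_vec w)) =
        (\<Sum>i = 1..N. if i = j then lam *\<^sub>R basis_vec w else 0)"
      using w Cons by (intro sum.cong) (auto simp: conservation_basis_vec)
    ultimately show ?thesis
      using w Cons by (simp add: sum.delta)
  qed
  have "S_op N lam (basis_vec w) = (\<Sum>i = 1..N. ?c *\<^sub>R creation i (basis_vec w))
      + ((\<Sum>i = 1..N. ?c *\<^sub>R annihilation i (basis_vec w))
      + (\<Sum>i = 1..N. lam *\<^sub>R conservation i (basis_vec w)))"
    by (simp add: S_op_def scaleR_add_right sum.distrib divide_inverse)
  also have "\<dots> = sum ?f (Push ` ?A) + sum ?f ?stay"
    unfolding cre rest ..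
  also have "\<dots> = sum ?f (moves N w)"
    unfolding moves_def by (rule sum.union_disjoint[symmetric]) auto
  finally show ?thesis .
qed

lemma S_op_power_vacuum:
  "(S_op N lam ^^ n) vacuum = (\<Sum>p\<in>paths N n. weight (1 / sqrt (real N)) lam p *\<^sub>R basis_vec (stack p))"
proof (induction n)
  case 0
  show ?case by (simp add: vacuum_def weight_def)
next
  case (Suc n)
  let ?c = "1 / sqrt (real N)"
  interpret bounded_linear "S_op N lam" by (rule bounded_linear_S_op)
  have inj: "inj_on (\<lambda>(p, s). s # p) (Sigma (paths N n) (\<lambda>p. moves N (stack p)))"
    by (auto simp: inj_on_def)
  have "(S_op N lam ^^ Suc n) vacuum =
      (\<Sum>p\<in>paths N n. weight ?c lam p *\<^sub>R S_op N lam (basis_vec (stack p)))"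
    by (simp add: Suc sum scaleR)
  also have "\<dots> = (\<Sum>p\<in>paths N n. \<Sum>s\<in>moves N (stack p).
      weight ?c lam (s # p) *\<^sub>R basis_vec (stack (s # p)))"
    using paths_stack
    by (intro sum.cong) (auto simp: S_op_basis_vec scaleR_sum_right weight_def mult.commute)
  also have "\<dots> = (\<Sum>(p, s)\<in>Sigma (paths N n) (\<lambda>p. moves N (stack p)).
      weight ?c lam (s # p) *\<^sub>R basis_vec (stack (s # p)))"
    by (rule sum.Sigma) (auto simp: finite_paths finite_moves)
  also have "\<dots> = (\<Sum>p\<in>paths N (Suc n). weight ?c lam p *\<^sub>R basis_vec (stack p))"
    unfolding paths.simps sum.reindex[OF inj] by (simp add: o_def case_prod_unfold)
  finally show ?case .
qed

lemma moment_eq_sum_paths: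
  "moment n lam N = of_real (\<Sum>p\<in>{p \<in> paths N n. stack p = []}. weight (1 / sqrt (real N)) lam p)"
proof -
  have "moment n lam N =
      (\<Sum>p\<in>paths N n. of_real (if stack p = [] then weight (1 / sqrt (real N)) lam p else 0))"
    unfolding moment_def vacuum_state_def S_op_power_vacuum
    by (subst vacuum_def, simp only: cinner_basis_vec_right coeff_sum)
       (rule sum.cong, auto simp: coeff_basis_vec)
  also have "\<dots> = of_real (\<Sum>p\<in>paths N n. if stack p = [] then weight (1 / sqrt (real N)) lam p else 0)"
    by simp
  also have "(\<Sum>p\<in>paths N n. if stack p = [] then weight (1 / sqrt (real N)) lam p else 0) =
      (\<Sum>p\<in>{p \<in> paths N n. stack p = []}. weight (1 / sqrt (real N)) lam p)"
    using finite_paths by (simp add: sum.inter_filter)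
  finally show ?thesis .
qed

section \<open>Opening times in a path\<close>

text \<open>The stack of opening times, parallel to the stack of labels. Unlike labels, opening times never
  repeat, so they identify the blocks.\<close>

fun open_times :: "step list \<Rightarrow> nat list" where
  "open_times [] = []"
| "open_times (Push i # p) = Suc (length p) # open_times p"
| "open_times (Stay # p) = open_times p"
| "open_times (Pop # p) = tl (open_times p)"

fun wf_path :: "step list \<Rightarrow> bool" where
  "wf_path [] = True"
| "wf_path (Push i # p) = wf_path p"
| "wf_path (s # p) = (wf_path p \<and> open_times p \<noteq> [])"

text \<open>Outside \<open>{1..length p}\<close> the value is a default; \<open>Stay\<close> is chosen since it carries no label.\<close>

primrec step_at :: "step list \<Rightarrow> nat \<Rightarrow> step" where
  "step_at [] t = Stay"
| "step_at (s # p) t = (if t = Suc (length p) then s else step_at p t)"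

text \<open>The block containing \<open>t\<close> is identified with its opening time: \<open>t\<close> itself for a push, and
  otherwise the top of the stack just before the step.\<close>

primrec opener :: "step list \<Rightarrow> nat \<Rightarrow> nat" where
  "opener [] t = 0"
| "opener (s # p) t = (if t = Suc (length p)
     then (case s of Push i \<Rightarrow> t | _ \<Rightarrow> hd (open_times p)) else opener p t)"

definition pushed_label :: "step list \<Rightarrow> nat \<Rightarrow> nat" where
  "pushed_label p t = (case step_at p t of Push i \<Rightarrow> i | _ \<Rightarrow> 0)"

fun pushes :: "step list \<Rightarrow> nat" where
  "pushes [] = 0"
| "pushes (Push i # p) = Suc (pushes p)"
| "pushes (s # p) = pushes p"

lemma set_tl_subset: "set (tl xs) \<subseteq> set xs"
  by (cases xs) auto

lemma open_times_range: "set (open_times p) \<subseteq> {1..length p}"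
  by (induction p rule: open_times.induct) (use set_tl_subset in fastforce)+

lemma open_times_decreasing: "sorted_wrt (>) (open_times p)"
proof (induction p rule: open_times.induct)
  case (2 i p)
  then show ?case using open_times_range[of p] by (auto simp: less_Suc_eq_le)
next
  case (4 p)
  then show ?case by (cases "open_times p") auto
qed auto

lemma stack_eq_map_pushed_label: "stack p = map (pushed_label p) (open_times p)"
proof (induction p rule: open_times.induct)
  case (2 i p)
  have "map (pushed_label (Push i # p)) (open_times p) = map (pushed_label p) (open_times p)"
    using open_times_range[of p] by (intro map_cong) (auto simp: pushed_label_def)
  with 2 show ?case by (simp add: pushed_label_def)
next
  case (3 p)
  have "map (pushed_label (Stay # p)) (open_times p) = map (pushed_label p) (open_times p)"
    using open_times_range[of p] by (intro map_cong) (auto simp: pushed_label_def)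
  with 3 show ?case by (simp add: pushed_label_def)
next
  case (4 p)
  have "map (pushed_label (Pop # p)) (tl (open_times p)) = map (pushed_label p) (tl (open_times p))"
    using open_times_range[of p] set_tl_subset[of "open_times p"] by (intro map_cong) (auto simp: pushed_label_def)
  with 4 show ?case by (simp add: map_tl)
qed auto

lemma stack_Nil_iff: "stack p = [] \<longleftrightarrow> open_times p = []"
  by (simp add: stack_eq_map_pushed_label)

lemma paths_wf: "p \<in> paths N n \<Longrightarrow> wf_path p"
proof (induction n arbitrary: p)
  case (Suc n)
  then obtain q s where "p = s # q" "q \<in> paths N n" "s \<in> moves N (stack q)" by auto
  with Suc.IH[of q] show ?case
    by (auto simp: moves_def stack_Nil_iff split: if_splits)
qed simp

text \<open>Generalising over paths that need not be closed makes this an induction on the path. Of its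
  steps, \<open>length (open_times p)\<close> are pushes still unmatched, \<open>k\<close> are pushes matched by \<open>k\<close> pops, and
  \<open>l\<close> are stays. Existential quantifiers avoid truncated differences.\<close>

lemma weight_wf_path:
  assumes "wf_path p"
  shows "\<exists>k l. pushes p = length (open_times p) + k \<and> length p = length (open_times p) + 2 * k + l \<and>
    weight c lam p = c ^ (length (open_times p) + 2 * k) * lam ^ l"
  using assms
proof (induction p rule: wf_path.induct)
  case 1
  show ?case by (simp add: weight_def)
next
  case (2 i p)
  then obtain k l where kl: "pushes p = length (open_times p) + k" "length p = length (open_times p) + 2 * k + l"
    "weight c lam p = c ^ (length (open_times p) + 2 * k) * lam ^ l" by auto
  show ?case
    by (rule exI[of _ k], rule exI[of _ l]) (use kl in \<open>simp add: weight_def\<close>)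
next
  case ("3_1" p)
  then obtain k l where kl: "pushes p = length (open_times p) + k" "length p = length (open_times p) + 2 * k + l"
    "weight c lam p = c ^ (length (open_times p) + 2 * k) * lam ^ l" by auto
  show ?case
    by (rule exI[of _ k], rule exI[of _ "Suc l"]) (use kl in \<open>simp add: weight_def\<close>)
next
  case ("3_2" p)
  then obtain k l where kl: "pushes p = length (open_times p) + k" "length p = length (open_times p) + 2 * k + l"
    "weight c lam p = c ^ (length (open_times p) + 2 * k) * lam ^ l" by auto
  obtain x xs where x: "open_times p = x # xs" using "3_2" by (cases "open_times p") auto
  show ?case
    by (rule exI[of _ "Suc k"], rule exI[of _ l]) (use kl x in \<open>simp add: weight_def\<close>)
qed

lemma weight_closed_path:
  assumes "p \<in> paths N n" "stack p = []"
  shows "2 * pushes p \<le> n"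
    "weight (1 / sqrt (real N)) lam p = lam ^ (n - 2 * pushes p) / real N ^ pushes p"
proof -
  have "wf_path p" "open_times p = []" "length p = n"
    using assms paths_wf paths_length by (auto simp: stack_Nil_iff)
  then obtain l where l: "n = 2 * pushes p + l"
    "weight (1 / sqrt (real N)) lam p = (1 / sqrt (real N)) ^ (2 * pushes p) * lam ^ l"
    using weight_wf_path[of p "1 / sqrt (real N)" lam] by auto
  have "(1 / sqrt (real N)) ^ (2 * pushes p) = 1 / real N ^ pushes p"
    by (simp add: power_mult power_divide)
  with l show "2 * pushes p \<le> n"
    "weight (1 / sqrt (real N)) lam p = lam ^ (n - 2 * pushes p) / real N ^ pushes p"
    by auto
qed

lemma moment_eq_count_paths:
  "moment n lam N = of_real (\<Sum>k = 0..n div 2.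
    real (card {p \<in> paths N n. stack p = [] \<and> pushes p = k}) / real N ^ k * lam ^ (n - 2 * k))"
proof -
  let ?P = "{p \<in> paths N n. stack p = []}"
  have fin: "finite ?P" using finite_paths by simp
  have "(\<Sum>p\<in>?P. weight (1 / sqrt (real N)) lam p) =
      (\<Sum>p\<in>?P. lam ^ (n - 2 * pushes p) / real N ^ pushes p)"
    by (rule sum.cong) (auto simp: weight_closed_path)
  also have "\<dots> = (\<Sum>k\<in>{0..n div 2}. \<Sum>p\<in>{p \<in> ?P. pushes p = k}.
      lam ^ (n - 2 * pushes p) / real N ^ pushes p)"
    using weight_closed_path(1)[of _ N n] by (intro sum.group[symmetric] fin) fastforce+
  also have "\<dots> = (\<Sum>k = 0..n div 2.
      real (card {p \<in> paths N n. stack p = [] \<and> pushes p = k}) / real N ^ k * lam ^ (n - 2 * k))"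
    by (rule sum.cong) (auto simp: conj_assoc)
  finally show ?thesis by (simp add: moment_eq_sum_paths)
qed

lemma paths_labels:
  "p \<in> paths N n \<Longrightarrow> t \<in> {1..length p} \<Longrightarrow> step_at p t = Push i \<Longrightarrow> i \<in> {1..N}"
proof (induction n arbitrary: p)
  case (Suc n)
  then obtain q s where "p = s # q" "q \<in> paths N n" "s \<in> moves N (stack q)" by auto
  with Suc.IH[of q] Suc.prems show ?case
    by (cases "t = Suc (length q)") (auto simp: moves_def split: if_splits)
qed simp

lemma opener_range: "wf_path p \<Longrightarrow> t \<in> {1..length p} \<Longrightarrow> opener p t \<in> {1..t}"
proof (induction p rule: wf_path.induct)
  case ("3_1" p)
  then show ?case using open_times_range[of p] hd_in_set[of "open_times p"] by (auto simp del: hd_in_set)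
next
  case ("3_2" p)
  then show ?case using open_times_range[of p] hd_in_set[of "open_times p"] by (auto simp del: hd_in_set)
qed auto

lemma opener_open_time: "x \<in> set (open_times p) \<Longrightarrow> opener p x = x"
proof (induction p rule: open_times.induct)
  case (2 i p)
  then show ?case using open_times_range[of p] by auto
next
  case (3 p)
  then show ?case using open_times_range[of p] by auto
next
  case (4 p)
  then show ?case using open_times_range[of p] set_tl_subset[of "open_times p"] by fastforce
qed auto

lemma open_times_le_hd: "x \<in> set (open_times p) \<Longrightarrow> x \<le> hd (open_times p)"
  using open_times_decreasing[of p] by (cases "open_times p") auto

lemma opener_opener: "wf_path p \<Longrightarrow> t \<in> {1..length p} \<Longrightarrow> opener p (opener p t) = opener p t"
proof (induction p rule: wf_path.induct)
  case (2 i p)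
  then show ?case using opener_range[of p t] by (cases "t = Suc (length p)") auto
next
  case ("3_1" p)
  then show ?case using opener_range[of p t] opener_open_time[of "hd (open_times p)" p] open_times_range[of p]
    hd_in_set[of "open_times p"] by (cases "t = Suc (length p)") (auto simp del: hd_in_set)
next
  case ("3_2" p)
  then show ?case using opener_range[of p t] opener_open_time[of "hd (open_times p)" p] open_times_range[of p]
    hd_in_set[of "open_times p"] by (cases "t = Suc (length p)") (auto simp del: hd_in_set)
qed auto

text \<open>While a block stays on the stack, every step belongs to it or to a block above it, and the
  stack of opening times decreases from top to bottom.\<close>

lemma opener_ge_open_time:
  "wf_path p \<Longrightarrow> x \<in> set (open_times p) \<Longrightarrow> x \<le> t \<Longrightarrow> t \<le> length p \<Longrightarrow> x \<le> opener p t"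
proof (induction p rule: wf_path.induct)
  case (2 i p)
  then show ?case using open_times_range[of p] by (cases "t = Suc (length p)") auto
next
  case ("3_1" p)
  then show ?case using open_times_le_hd by (cases "t = Suc (length p)") auto
next
  case ("3_2" p)
  then show ?case using open_times_le_hd set_tl_subset[of "open_times p"] by (cases "t = Suc (length p)") auto
qed auto

text \<open>Noncrossingness in terms of opening times: between the opening of a block and any later element
  \<open>c\<close> of it, no block opened earlier is active, since the block stays on the stack throughout.\<close>

lemma opener_nested:
  "wf_path p \<Longrightarrow> 1 \<le> c \<Longrightarrow> c \<le> length p \<Longrightarrow> opener p c \<le> b \<Longrightarrow> b \<le> c \<Longrightarrow> opener p c \<le> opener p b"
proof (induction p rule: wf_path.induct)
  case (2 i p)
  then show ?case by (cases "c = Suc (length p)"; cases "b = Suc (length p)") auto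
next
  case ("3_1" p)
  then show ?case using opener_ge_open_time[of p "hd (open_times p)" b]
    by (cases "c = Suc (length p)"; cases "b = Suc (length p)") auto
next
  case ("3_2" p)
  then show ?case using opener_ge_open_time[of p "hd (open_times p)" b]
    by (cases "c = Suc (length p)"; cases "b = Suc (length p)") auto
qed auto

lemma step_at_Push_iff:
  "wf_path p \<Longrightarrow> t \<in> {1..length p} \<Longrightarrow> (\<exists>i. step_at p t = Push i) \<longleftrightarrow> opener p t = t"
proof (induction p rule: wf_path.induct)
  case ("3_1" p)
  then show ?case using open_times_range[of p] hd_in_set[of "open_times p"] by (auto simp del: hd_in_set)
next
  case ("3_2" p)
  then show ?case using open_times_range[of p] hd_in_set[of "open_times p"] by (auto simp del: hd_in_set)
qed auto

text \<open>A popped block is never active again. Its absence from the final stack is carried along because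
  it is what the induction needs: a later stay or pop concerns a block that is still on the stack.\<close>

lemma closed_after_Pop:
  "wf_path p \<Longrightarrow> t \<in> {1..length p} \<Longrightarrow> step_at p t = Pop \<Longrightarrow>
    opener p t \<notin> set (open_times p) \<and> (\<forall>s\<in>{1..length p}. opener p s = opener p t \<longrightarrow> s \<le> t)"
proof (induction p rule: wf_path.induct)
  case (2 i p)
  then have t: "t \<in> {1..length p}" by (auto split: if_splits)
  with 2 opener_range[of p t] show ?case by (auto simp: le_Suc_eq)
next
  case ("3_1" p)
  then have t: "t \<in> {1..length p}" by (auto split: if_splits)
  with "3_1" hd_in_set[of "open_times p"] show ?case by (auto simp: le_Suc_eq simp del: hd_in_set)
next
  case ("3_2" p)
  then obtain x xs where x: "open_times p = x # xs" by (cases "open_times p") auto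
  show ?case
  proof (cases "t = Suc (length p)")
    case True
    with "3_2" x show ?thesis using open_times_decreasing[of p] by auto
  next
    case False
    with "3_2" x show ?thesis by (auto simp: le_Suc_eq)
  qed
qed auto

lemma closed_by_Pop:
  "wf_path p \<Longrightarrow> t \<in> {1..length p} \<Longrightarrow> opener p t \<notin> set (open_times p) \<Longrightarrow>
    \<exists>s\<in>{1..length p}. step_at p s = Pop \<and> opener p s = opener p t"
proof (induction p rule: wf_path.induct)
  case (2 i p)
  then have t: "t \<in> {1..length p}" "opener p t \<notin> set (open_times p)" by (auto split: if_splits)
  with 2 obtain s where s: "s \<in> {1..length p}" "step_at p s = Pop" "opener p s = opener p t" by auto
  with t show ?case by (intro bexI[of _ s]) auto
next
  case ("3_1" p)
  then have t: "t \<in> {1..length p}" "opener p t \<notin> set (open_times p)"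
    using hd_in_set[of "open_times p"] by (auto split: if_splits simp del: hd_in_set)
  with "3_1" obtain s where s: "s \<in> {1..length p}" "step_at p s = Pop" "opener p s = opener p t" by auto
  with t show ?case by (intro bexI[of _ s]) auto
next
  case ("3_2" p)
  then obtain x xs where x: "open_times p = x # xs" by (cases "open_times p") auto
  show ?case
  proof (cases "opener (Pop # p) t = x")
    case True
    then show ?thesis using x by (intro bexI[of _ "Suc (length p)"]) auto
  next
    case False
    with "3_2" x have t: "t \<in> {1..length p}" "opener p t \<notin> set (open_times p)" by (auto split: if_splits)
    with "3_2" obtain s where s: "s \<in> {1..length p}" "step_at p s = Pop" "opener p s = opener p t"
      by auto
    with t show ?thesis by (intro bexI[of _ s]) auto
  qed
qed auto

section \<open>Noncrossing partitions as paths\<close>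

definition block_of :: "nat set set \<Rightarrow> nat \<Rightarrow> nat set" where
  "block_of \<pi> t = (THE B. B \<in> \<pi> \<and> t \<in> B)"

text \<open>This is the state after the step at time \<open>t\<close>, so a block counts at its minimum and no longer at
  its maximum.\<close>

definition openers :: "nat set set \<Rightarrow> nat \<Rightarrow> nat set" where
  "openers \<pi> t = Min ` {B \<in> \<pi>. Min B \<le> t \<and> t < Max B}"

text \<open>Among blocks that are open at the same time, the later one has opened, the deeper it is nested;
  so the innermost label comes first.\<close>

definition open_word :: "nat set set \<Rightarrow> (nat set \<Rightarrow> nat) \<Rightarrow> nat \<Rightarrow> nat list" where
  "open_word \<pi> L t = map (\<lambda>x. L (block_of \<pi> x)) (rev (sorted_list_of_set (openers \<pi> t)))"

definition step_of :: "nat set set \<Rightarrow> (nat set \<Rightarrow> nat) \<Rightarrow> nat \<Rightarrow> step" where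
  "step_of \<pi> L t = (let B = block_of \<pi> t in
     if t = Min B then Push (L B) else if t = Max B then Pop else Stay)"

primrec path_of :: "nat set set \<Rightarrow> (nat set \<Rightarrow> nat) \<Rightarrow> nat \<Rightarrow> step list" where
  "path_of \<pi> L 0 = []"
| "path_of \<pi> L (Suc t) = step_of \<pi> L (Suc t) # path_of \<pi> L t"

lemma length_path_of [simp]: "length (path_of \<pi> L t) = t"
  by (induction t) auto

lemma step_at_path_of: "s \<in> {1..t} \<Longrightarrow> step_at (path_of \<pi> L t) s = step_of \<pi> L s"
  by (induction t) auto

lemma path_of_eqI:
  "(\<And>t. t \<in> {1..length p} \<Longrightarrow> step_of \<pi> L t = step_at p t) \<Longrightarrow> path_of \<pi> L (length p) = p"
proof (induction p)
  case (Cons s p)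
  have "path_of \<pi> L (length p) = p"
  proof (rule Cons.IH)
    fix t assume "t \<in> {1..length p}"
    then show "step_of \<pi> L t = step_at p t" using Cons.prems[of t] by auto
  qed
  then show ?case using Cons.prems[of "Suc (length p)"] by simp
qed simp

lemma vword_appendD: "vword (u @ w) \<Longrightarrow> vword w"
  by (induction u) (auto dest: vword_ConsD)

lemma sorted_list_of_set_eqI:
  assumes "sorted_wrt (<) xs" "set xs = A"
  shows "sorted_list_of_set A = (xs :: nat list)"
  using assms by (intro strict_sorted_equal) auto

locale nc2_partition =
  fixes \<pi> :: "nat set set" and n :: nat
  assumes NC2: "\<pi> \<in> NC2 n"
begin

lemma finite_blocks: "finite \<pi>"
  using NC2 by (auto simp: NC2_def partition_on_def intro: finite_UnionD)

lemma block_subset: "B \<in> \<pi> \<Longrightarrow> B \<subseteq> {1..n}"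
  using NC2 by (auto simp: NC2_def partition_on_def)

lemma finite_block: "B \<in> \<pi> \<Longrightarrow> finite B"
  by (rule finite_subset[OF block_subset]) auto

lemma block_nonempty: "B \<in> \<pi> \<Longrightarrow> B \<noteq> {}"
  using NC2 by (auto simp: NC2_def partition_on_def)

lemma Min_in_block: "B \<in> \<pi> \<Longrightarrow> Min B \<in> B"
  by (simp add: finite_block block_nonempty)

lemma Max_in_block: "B \<in> \<pi> \<Longrightarrow> Max B \<in> B"
  by (simp add: finite_block block_nonempty)

lemma Min_less_Max: assumes "B \<in> \<pi>" shows "Min B < Max B"
proof (rule ccontr)
  assume "\<not> Min B < Max B"
  then have "x = Min B" if "x \<in> B" for x
    using Max_ge[OF finite_block[OF assms] that] Min_le[OF finite_block[OF assms] that] by linarith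
  then have "B \<subseteq> {Min B}" by blast
  then have "card B \<le> 1" using card_mono[of "{Min B}" B] by simp
  moreover have "2 \<le> card B" using assms NC2 by (auto simp: NC2_def)
  ultimately show False by simp
qed

lemma block_unique: "B \<in> \<pi> \<Longrightarrow> B' \<in> \<pi> \<Longrightarrow> x \<in> B \<Longrightarrow> x \<in> B' \<Longrightarrow> B = B'"
  using NC2 by (auto simp: NC2_def partition_on_def disjoint_def)

lemma block_of_eq: "B \<in> \<pi> \<Longrightarrow> x \<in> B \<Longrightarrow> block_of \<pi> x = B"
  unfolding block_of_def by (rule the_equality) (simp, metis block_unique)

lemma block_of_Min [simp]: "B \<in> \<pi> \<Longrightarrow> block_of \<pi> (Min B) = B"
  by (simp add: block_of_eq Min_in_block)

lemma block_of: assumes "t \<in> {1..n}" shows "block_of \<pi> t \<in> \<pi>" "t \<in> block_of \<pi> t"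
proof -
  have "t \<in> \<Union>\<pi>" using assms NC2 by (auto simp: NC2_def partition_on_def)
  then obtain B where "B \<in> \<pi>" "t \<in> B" by blast
  then show "block_of \<pi> t \<in> \<pi>" "t \<in> block_of \<pi> t" by (simp_all add: block_of_eq)
qed

lemma Min_block_inject:
  assumes "B \<in> \<pi>" "B' \<in> \<pi>" "Min B = Min B'"
  shows "B = B'"
proof -
  have "Min B \<in> B'" unfolding assms(3) by (rule Min_in_block[OF assms(2)])
  with Min_in_block[OF assms(1)] show ?thesis using block_unique[OF assms(1,2)] by blast
qed

lemma no_crossing:
  assumes "B \<in> \<pi>" "B' \<in> \<pi>" "B \<noteq> B'" "a \<in> B" "b \<in> B'" "c \<in> B" "d \<in> B'"
    "a < b" "b < c" "c < d"
  shows False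
proof -
  have "noncrossing \<pi>" using NC2 by (simp add: NC2_def)
  then have "\<not> (\<exists>a\<in>B. \<exists>b\<in>B'. \<exists>c\<in>B. \<exists>d\<in>B'. a < b \<and> b < c \<and> c < d)"
    using assms(1-3) unfolding noncrossing_def by blast
  with assms(4-) show False by blast
qed

text \<open>A block that meets the interior of the span of another one is enclosed by it; an overhang at
  either end would be a crossing.\<close>

lemma enclosed:
  assumes B: "B \<in> \<pi>" and B': "B' \<in> \<pi>" and x: "x \<in> B'" "Min B < x" "x < Max B" and ne: "B \<noteq> B'"
  shows "Min B < Min B'" "Max B' < Max B"
proof -
  show "Min B < Min B'"
  proof (rule ccontr)
    assume "\<not> Min B < Min B'"
    moreover have "Min B \<noteq> Min B'" using Min_block_inject B B' ne by blast
    ultimately have "Min B' < Min B" by simp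
    from no_crossing[OF B' B ne[symmetric] Min_in_block[OF B'] Min_in_block[OF B] x(1)
        Max_in_block[OF B] this x(2,3)]
    show False .
  qed
  show "Max B' < Max B"
  proof (rule ccontr)
    assume "\<not> Max B' < Max B"
    moreover have "Max B \<noteq> Max B'"
      using block_unique[OF B B', of "Max B"] Max_in_block[OF B] Max_in_block[OF B'] ne by auto
    ultimately have "Max B < Max B'" by simp
    from no_crossing[OF B B' ne Min_in_block[OF B] x(1) Max_in_block[OF B]
        Max_in_block[OF B'] x(2,3) this]
    show False .
  qed
qed

text \<open>Since blocks do not cross, a block whose minimum lies within the span of \<open>B'\<close> fits into a single
  gap of \<open>B'\<close>. Thus \<open>nested B' B\<close> says that \<open>B'\<close> has opened before time \<open>Min B\<close> and is still open.\<close>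

lemma nested_iff:
  assumes B: "B \<in> \<pi>" and B': "B' \<in> \<pi>"
  shows "nested B' B \<longleftrightarrow> Min B' < Min B \<and> Min B < Max B'"
proof -
  define l where "l = sorted_list_of_set B'"
  have l: "set l = B'" "sorted_wrt (<) l"
    using finite_block[OF B'] by (auto simp: l_def)
  then have ss: "l ! i < l ! j" if "i < j" "j < length l" for i j
    using that by (simp add: sorted_wrt_nth_less)
  have nth: "l ! i \<in> B'" if "i < length l" for i
    using that l(1) nth_mem by blast
  show ?thesis
  proof
    assume "nested B' B"
    then obtain q where q: "q \<in> {1..<length l}" "l ! (q - 1) < Min B" "Max B < l ! q"
      by (auto simp: nested_def l_def Let_def)
    have "Min B' \<le> l ! (q - 1)" "l ! q \<le> Max B'"
      using q(1) nth finite_block[OF B'] by auto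
    with q(2,3) Min_less_Max[OF B] show "Min B' < Min B \<and> Min B < Max B'" by linarith
  next
    assume as: "Min B' < Min B \<and> Min B < Max B'"
    then have ne: "B \<noteq> B'" by auto
    obtain j where j: "j < length l" "l ! j = Max B'"
      using Max_in_block[OF B'] l(1) by (metis in_set_conv_nth)
    \<comment> \<open>\<open>l ! q\<close> is the first element of \<open>B'\<close> after \<open>Min B\<close>, so the gap of \<open>B'\<close> in question ends there.\<close>
    define q where "q = (LEAST i. i < length l \<and> Min B < l ! i)"
    have q: "q < length l" "Min B < l ! q"
      using LeastI[of "\<lambda>i. i < length l \<and> Min B < l ! i" j] j as by (auto simp: q_def)
    have q0: "q \<noteq> 0"
    proof
      assume "q = 0"
      obtain i where i: "i < length l" "l ! i = Min B'"
        using Min_in_block[OF B'] l(1) by (metis in_set_conv_nth)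
      have "l ! 0 \<le> l ! i" using ss[of 0 i] i by (cases "i = 0") auto
      with i as q \<open>q = 0\<close> show False by simp
    qed
    have "\<not> Min B < l ! (q - 1)"
      using not_less_Least[of "q - 1" "\<lambda>i. i < length l \<and> Min B < l ! i"] q q0
      by (auto simp: q_def[symmetric])
    moreover have "l ! (q - 1) \<noteq> Min B"
    proof
      assume "l ! (q - 1) = Min B"
      then have "Min B \<in> B'" using nth[of "q - 1"] q(1) by simp
      then show False using block_unique[OF B B' Min_in_block[OF B]] ne by blast
    qed
    ultimately have lo: "l ! (q - 1) < Min B" by simp
    have ql: "q - 1 < length l" using q(1) by simp
    have "\<not> l ! q < Max B"
      using no_crossing[OF B' B ne[symmetric] nth[OF ql] Min_in_block[OF B] nth[OF q(1)]
        Max_in_block[OF B] lo q(2)] by blast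
    moreover have "l ! q \<noteq> Max B"
    proof
      assume "l ! q = Max B"
      then have "Max B \<in> B'" using nth[OF q(1)] by simp
      then show False using block_unique[OF B B' Max_in_block[OF B]] ne by blast
    qed
    ultimately have "Max B < l ! q" by simp
    with lo q q0 show "nested B' B"
      unfolding nested_def l_def[symmetric] Let_def by (intro bexI[of _ q]) auto
  qed
qed

lemma open_Suc_iff:
  assumes "B' \<in> \<pi>" "Suc t \<notin> B'"
  shows "(Min B' \<le> Suc t \<and> Suc t < Max B') \<longleftrightarrow> (Min B' \<le> t \<and> t < Max B')"
proof -
  have "Min B' \<noteq> Suc t" "Max B' \<noteq> Suc t"
    using assms Min_in_block[of B'] Max_in_block[of B'] by auto
  then show ?thesis by auto
qed

lemma openers_split:
  assumes "B \<in> \<pi>"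
  shows "openers \<pi> t = Min ` {B' \<in> \<pi> - {B}. Min B' \<le> t \<and> t < Max B'} \<union>
    (if Min B \<le> t \<and> t < Max B then {Min B} else {})"
  unfolding openers_def using assms by auto

text \<open>One step of time changes the set of open blocks only at the block \<open>B\<close> of the new point. The last
  part is where noncrossingness enters: if the new point is not the first element of \<open>B\<close>, then \<open>B\<close>
  is the most recently opened of the open blocks, so it is on top of the stack.\<close>

lemma openers_Suc:
  assumes "B \<in> \<pi>" "Suc t \<in> B"
  shows "Suc t = Min B \<Longrightarrow> openers \<pi> (Suc t) = insert (Suc t) (openers \<pi> t)"
    and "Suc t \<noteq> Min B \<Longrightarrow> Min B \<in> openers \<pi> t"
    and "Suc t = Max B \<Longrightarrow> openers \<pi> (Suc t) = openers \<pi> t - {Min B}"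
    and "Suc t \<noteq> Min B \<Longrightarrow> Suc t \<noteq> Max B \<Longrightarrow> openers \<pi> (Suc t) = openers \<pi> t"
    and "Suc t \<noteq> Min B \<Longrightarrow> x \<in> openers \<pi> t \<Longrightarrow> x \<le> Min B"
proof -
  let ?R = "\<lambda>t. Min ` {B' \<in> \<pi> - {B}. Min B' \<le> t \<and> t < Max B'}"
  have rest: "?R (Suc t) = ?R t"
  proof -
    have "{B' \<in> \<pi> - {B}. Min B' \<le> Suc t \<and> Suc t < Max B'} = {B' \<in> \<pi> - {B}. Min B' \<le> t \<and> t < Max B'}"
      using open_Suc_iff block_unique[OF assms(1) _ assms(2)] by blast
    then show ?thesis by simp
  qed
  have notin: "Min B \<notin> ?R t" using Min_block_inject assms(1) by auto
  have le: "Min B \<le> Suc t" "Suc t \<le> Max B"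
    using assms finite_block by auto
  have lt: "Min B < Max B" by (rule Min_less_Max[OF assms(1)])
  show "Suc t = Min B \<Longrightarrow> openers \<pi> (Suc t) = insert (Suc t) (openers \<pi> t)"
    unfolding openers_split[OF assms(1)] rest using lt by auto
  show "Suc t \<noteq> Min B \<Longrightarrow> Min B \<in> openers \<pi> t"
    unfolding openers_split[OF assms(1)] using le by auto
  show "Suc t = Max B \<Longrightarrow> openers \<pi> (Suc t) = openers \<pi> t - {Min B}"
    unfolding openers_split[OF assms(1)] rest using notin lt by auto
  show "Suc t \<noteq> Min B \<Longrightarrow> Suc t \<noteq> Max B \<Longrightarrow> openers \<pi> (Suc t) = openers \<pi> t"
    unfolding openers_split[OF assms(1)] rest using le by auto
  assume ne: "Suc t \<noteq> Min B" and "x \<in> openers \<pi> t"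
  then obtain B' where B': "B' \<in> \<pi>" "x = Min B'" "Min B' \<le> t" "t < Max B'"
    by (auto simp: openers_def)
  show "x \<le> Min B"
  proof (rule ccontr)
    assume "\<not> x \<le> Min B"
    then have c: "Min B < Min B'" "B \<noteq> B'" using B' by auto
    have "Suc t \<noteq> Max B'"
      using block_unique[OF assms(1) B'(1) assms(2)] Max_in_block[OF B'(1)] c(2) by auto
    then have "Suc t < Max B'" using B' by simp
    from enclosed(1)[OF B'(1) assms(1) assms(2) _ this] B' c show False by auto
  qed
qed

lemma step_of_eq:
  "B \<in> \<pi> \<Longrightarrow> t \<in> B \<Longrightarrow>
    step_of \<pi> L t = (if t = Min B then Push (L B) else if t = Max B then Pop else Stay)"
  by (simp add: step_of_def block_of_eq Let_def)

text \<open>The machine run on the steps of a partition reproduces the partition: its stack holds the open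
  blocks, and its notion of the current block is the true one. As stacks of opening times are
  decreasing, their sets determine them.\<close>

lemma path_of_invariant:
  "t \<le> n \<Longrightarrow> wf_path (path_of \<pi> L t) \<and> set (open_times (path_of \<pi> L t)) = openers \<pi> t \<and>
    (\<forall>s\<in>{1..t}. opener (path_of \<pi> L t) s = Min (block_of \<pi> s))"
proof (induction t)
  case 0
  have "openers \<pi> 0 = {}"
    unfolding openers_def using Min_in_block block_subset by force
  then show ?case by simp
next
  case (Suc t)
  let ?p = "path_of \<pi> L t"
  have IH: "wf_path ?p" "set (open_times ?p) = openers \<pi> t"
    "\<And>s. s \<in> {1..t} \<Longrightarrow> opener ?p s = Min (block_of \<pi> s)"
    using Suc by auto
  define B where "B = block_of \<pi> (Suc t)"
  have B: "B \<in> \<pi>" "Suc t \<in> B" using Suc.prems block_of[of "Suc t"] by (auto simp: B_def)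
  note O = openers_Suc[OF B]
  have hd: "open_times ?p \<noteq> [] \<and> hd (open_times ?p) = Min B" if "Suc t \<noteq> Min B"
  proof -
    have mem: "Min B \<in> set (open_times ?p)" using O(2) that IH(2) by simp
    then have "open_times ?p \<noteq> []" by auto
    moreover have "hd (open_times ?p) \<le> Min B" using O(5) that IH(2) \<open>open_times ?p \<noteq> []\<close> hd_in_set by blast
    ultimately show ?thesis using open_times_le_hd[OF mem] by simp
  qed
  have own_old: "opener (path_of \<pi> L (Suc t)) s = Min (block_of \<pi> s)" if "s \<in> {1..t}" for s
    using IH(3) that by auto
  consider "Suc t = Min B" | "Suc t \<noteq> Min B" "Suc t = Max B" | "Suc t \<noteq> Min B" "Suc t \<noteq> Max B"
    by blast
  then show ?case
  proof cases
    case 1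
    then have l: "step_of \<pi> L (Suc t) = Push (L B)" using step_of_eq[OF B, of L] by simp
    have "opener (path_of \<pi> L (Suc t)) (Suc t) = Min (block_of \<pi> (Suc t))"
    proof -
      have "opener (path_of \<pi> L (Suc t)) (Suc t) = Suc t" using l by simp
      then show ?thesis unfolding B_def[symmetric] using 1 by (rule trans)
    qed
    moreover have "set (open_times (path_of \<pi> L (Suc t))) = openers \<pi> (Suc t)"
      using l O(1)[OF 1] IH(2) by simp
    moreover have "wf_path (path_of \<pi> L (Suc t))" using l IH(1) by simp
    ultimately show ?thesis using own_old by (auto simp only: atLeastAtMostSuc_conv atLeastAtMost_iff le_Suc_eq)
  next
    case 2
    then have l: "step_of \<pi> L (Suc t) = Pop" using step_of_eq[OF B, of L] by simp
    have "opener (path_of \<pi> L (Suc t)) (Suc t) = Min (block_of \<pi> (Suc t))"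
      using l hd[OF 2(1)] by (simp add: B_def[symmetric])
    moreover have "set (open_times (path_of \<pi> L (Suc t))) = openers \<pi> (Suc t)"
    proof -
      obtain xs where xs: "open_times ?p = Min B # xs" using hd[OF 2(1)] by (cases "open_times ?p") auto
      then have "Min B \<notin> set xs" using open_times_decreasing[of ?p] by auto
      then show ?thesis using xs l O(3)[OF 2(2)] IH(2) by auto
    qed
    moreover have "wf_path (path_of \<pi> L (Suc t))" using l IH(1) hd[OF 2(1)] by simp
    ultimately show ?thesis using own_old by (auto simp only: atLeastAtMostSuc_conv atLeastAtMost_iff le_Suc_eq)
  next
    case 3
    then have l: "step_of \<pi> L (Suc t) = Stay" using step_of_eq[OF B, of L] by simp
    have "opener (path_of \<pi> L (Suc t)) (Suc t) = Min (block_of \<pi> (Suc t))"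
      using l hd[OF 3(1)] by (simp add: B_def[symmetric])
    moreover have "set (open_times (path_of \<pi> L (Suc t))) = openers \<pi> (Suc t)"
      using l O(4)[OF 3] IH(2) by simp
    moreover have "wf_path (path_of \<pi> L (Suc t))" using l IH(1) hd[OF 3(1)] by simp
    ultimately show ?thesis using own_old by (auto simp only: atLeastAtMostSuc_conv atLeastAtMost_iff le_Suc_eq)
  qed
qed

lemma pushed_label_path_of: "B \<in> \<pi> \<Longrightarrow> Min B \<le> t \<Longrightarrow> pushed_label (path_of \<pi> L t) (Min B) = L B"
proof -
  assume B: "B \<in> \<pi>" "Min B \<le> t"
  then have "Min B \<in> {1..t}" using Min_in_block[of B] block_subset[of B] by auto
  then show ?thesis using B by (simp add: pushed_label_def step_at_path_of step_of_def)
qed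

lemma stack_path_of: assumes "t \<le> n" shows "stack (path_of \<pi> L t) = open_word \<pi> L t"
proof -
  let ?p = "path_of \<pi> L t"
  have "sorted_wrt (<) (rev (open_times ?p))"
    using open_times_decreasing[of ?p] by (simp add: sorted_wrt_rev)
  then have "sorted_list_of_set (openers \<pi> t) = rev (open_times ?p)"
    using path_of_invariant[OF assms] by (intro sorted_list_of_set_eqI) auto
  then have "open_word \<pi> L t = map (\<lambda>x. L (block_of \<pi> x)) (open_times ?p)"
    by (simp add: open_word_def)
  also have "\<dots> = map (pushed_label ?p) (open_times ?p)"
    using path_of_invariant[OF assms] by (intro map_cong) (auto simp: openers_def pushed_label_path_of)
  finally show ?thesis by (simp add: stack_eq_map_pushed_label)
qed

lemma path_of_closed: "open_times (path_of \<pi> L n) = []"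
proof -
  have "openers \<pi> n = {}"
    unfolding openers_def using Max_in_block block_subset by fastforce
  then show ?thesis using path_of_invariant[of n] by simp
qed

lemma pushes_path_of_prefix: "t \<le> n \<Longrightarrow> pushes (path_of \<pi> L t) = card {B \<in> \<pi>. Min B \<le> t}"
proof (induction t)
  case 0
  have "{B \<in> \<pi>. Min B \<le> 0} = {}"
    using Min_in_block block_subset by fastforce
  then show ?case by (simp only: path_of.simps pushes.simps card.empty)
next
  case (Suc t)
  define B where "B = block_of \<pi> (Suc t)"
  have B: "B \<in> \<pi>" "Suc t \<in> B" using Suc.prems block_of[of "Suc t"] by (auto simp: B_def)
  show ?case
  proof (cases "Suc t = Min B")
    case True
    have "Min X = Suc t \<longleftrightarrow> X = B" if "X \<in> \<pi>" for X
      using True Min_block_inject[OF that B(1)] by auto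
    then have "{B' \<in> \<pi>. Min B' \<le> Suc t} = insert B {B' \<in> \<pi>. Min B' \<le> t}"
      using B(1) unfolding le_Suc_eq by blast
    moreover have "B \<notin> {B' \<in> \<pi>. Min B' \<le> t}" using True by auto
    moreover have "step_of \<pi> L (Suc t) = Push (L B)"
      using True step_of_eq[OF B, of L] by simp
    ultimately show ?thesis using Suc finite_blocks by simp
  next
    case False
    have "{B' \<in> \<pi>. Min B' \<le> Suc t} = {B' \<in> \<pi>. Min B' \<le> t}"
      using False B block_unique Min_in_block by (auto simp: le_Suc_eq) metis
    moreover have "step_of \<pi> L (Suc t) \<in> {Stay, Pop}"
      using False step_of_eq[OF B, of L] by simp
    ultimately show ?thesis using Suc by auto
  qed
qed

lemma pushes_path_of: "pushes (path_of \<pi> L n) = card \<pi>"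
proof -
  have "{B \<in> \<pi>. Min B \<le> n} = \<pi>"
    using Min_in_block block_subset by fastforce
  then show ?thesis using pushes_path_of_prefix[of n] by simp
qed

text \<open>Stays and pops are allowed because the stack is not empty, so only pushes test the V-property;
  that is why it is required at the times \<open>Min B\<close> only.\<close>

lemma path_of_in_paths:
  assumes "\<And>B. B \<in> \<pi> \<Longrightarrow> L B \<in> {1..N}" "\<And>B. B \<in> \<pi> \<Longrightarrow> vword (open_word \<pi> L (Min B))"
  shows "t \<le> n \<Longrightarrow> path_of \<pi> L t \<in> paths N t"
proof (induction t)
  case (Suc t)
  define B where "B = block_of \<pi> (Suc t)"
  have B: "B \<in> \<pi>" "Suc t \<in> B" using Suc.prems block_of[of "Suc t"] by (auto simp: B_def)
  have wf: "wf_path (path_of \<pi> L (Suc t))" using path_of_invariant Suc.prems by blast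
  have st: "stack (path_of \<pi> L (Suc t)) = open_word \<pi> L (Suc t)" using stack_path_of Suc.prems by blast
  have "step_of \<pi> L (Suc t) \<in> moves N (stack (path_of \<pi> L t))"
  proof (cases "Suc t = Min B")
    case True
    then have l: "step_of \<pi> L (Suc t) = Push (L B)"
      using step_of_eq[OF B, of L] by simp
    have "vword (stack (path_of \<pi> L (Suc t)))" using st assms(2)[OF B(1)] True by simp
    with l assms(1)[OF B(1)] show ?thesis by (auto simp: moves_def)
  next
    case False
    then have "step_of \<pi> L (Suc t) \<in> {Stay, Pop}"
      using step_of_eq[OF B, of L] by simp
    with wf show ?thesis by (auto simp: moves_def stack_Nil_iff)
  qed
  with Suc show ?case by auto
qed simp

lemma path_of_prefix_in_paths: "path_of \<pi> L (t + d) \<in> paths N (t + d) \<Longrightarrow> path_of \<pi> L t \<in> paths N t"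
  by (induction d) auto

lemma open_word_vword:
  assumes "path_of \<pi> L n \<in> paths N n" "t \<le> n"
  shows "vword (open_word \<pi> L t)"
  using path_of_prefix_in_paths[of L t "n - t" N] assms paths_stack[of "path_of \<pi> L t" N t]
  by (simp add: stack_path_of)

section \<open>V-monotone labelings\<close>

text \<open>From left to right, the blocks open at \<open>Min B\<close> form a chain, which extends to a maximal one; a
  block of that chain opened no later than \<open>B\<close> is comparable with \<open>B\<close> and hence still open at
  \<open>Min B\<close>. So the word at \<open>Min B\<close> is what remains of the word of the chain after dropping first
  letters. From right to left, a maximal chain with innermost block \<open>B\<close> consists of all blocks open
  at \<open>Min B\<close>: any such block contains the time \<open>Min B\<close> in its span, as do all blocks of the chain, so
  it is comparable with each of them.\<close>

lemma V_monotone_iff: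
  "V_monotone \<pi> L \<longleftrightarrow> (\<forall>B\<in>\<pi>. vword (open_word \<pi> L (Min B)))"
proof
  assume V: "V_monotone \<pi> L"
  show "\<forall>B\<in>\<pi>. vword (open_word \<pi> L (Min B))"
  proof
    fix B assume B: "B \<in> \<pi>"
    let ?Os = "{B' \<in> \<pi>. Min B' \<le> Min B \<and> Min B < Max B'}"
    let ?Ch = "{C. pred_on.chain \<pi> nested C}"
    have "finite ?Ch"
      by (rule finite_subset[of _ "Pow \<pi>"]) (auto simp: pred_on.chain_def finite_blocks)
    moreover have "?Os \<in> ?Ch"
    proof -
      have "nested X Y \<or> X = Y \<or> nested Y X" if "X \<in> ?Os" "Y \<in> ?Os" for X Y
        using that nested_iff Min_block_inject[of X Y]
        by (cases "Min X" "Min Y" rule: linorder_cases) auto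
      then show ?thesis by (auto simp: pred_on.chain_def)
    qed
    \<comment> \<open>There are finitely many chains, so one above \<open>?Os\<close> is maximal.\<close>
    ultimately obtain C where C: "C \<in> ?Ch" "?Os \<subseteq> C" "\<And>D. D \<in> ?Ch \<Longrightarrow> C \<subseteq> D \<Longrightarrow> C = D"
      using finite_has_maximal2[of ?Ch ?Os] by auto
    have max: "pred_on.maxchain \<pi> nested C"
      unfolding pred_on.maxchain_def using C(1,3) by auto
    have sub: "C \<subseteq> \<pi>" and cmp: "\<And>X Y. X \<in> C \<Longrightarrow> Y \<in> C \<Longrightarrow> nested X Y \<or> X = Y \<or> nested Y X"
      using C(1) by (auto simp: pred_on.chain_def)
    have fin: "finite C" using sub finite_blocks finite_subset by blast
    define xs where "xs = sorted_list_of_set (Min ` C)"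
    have xs: "set xs = Min ` C" "sorted_wrt (<) xs" using fin by (auto simp: xs_def)
    have "sorted_wrt nested (map (block_of \<pi>) xs)"
      unfolding sorted_wrt_map
    proof (rule sorted_wrt_mono_rel[OF _ xs(2)])
      fix x y assume "x \<in> set xs" "y \<in> set xs" "x < y"
      then obtain X Y where XY: "X \<in> C" "Y \<in> C" "x = Min X" "y = Min Y" "Min X < Min Y"
        using xs(1) by auto
      then have "X \<in> \<pi>" "Y \<in> \<pi>" using sub by auto
      with cmp[OF XY(1,2)] XY
      show "nested (block_of \<pi> x) (block_of \<pi> y)" using nested_iff[of X Y] nested_iff[of Y X] by auto
    qed
    moreover have "set (map (block_of \<pi>) xs) = C"
      using xs(1) sub by (force simp: image_image)
    ultimately have vw: "vword (rev (map L (map (block_of \<pi>) xs)))"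
      using V max unfolding V_monotone_def by metis
    \<comment> \<open>In the increasing list of opening times, those up to \<open>Min B\<close> come first.\<close>
    have tw: "takeWhile (\<lambda>x. x \<le> Min B) xs = filter (\<lambda>x. x \<le> Min B) xs"
      using xs(2) by (induction xs) (auto simp: filter_empty_conv empty_filter_conv)
    have "set (filter (\<lambda>x. x \<le> Min B) xs) = {x \<in> set xs. x \<le> Min B}" by auto
    also have "\<dots> = openers \<pi> (Min B)"
    proof (intro equalityI subsetI)
      fix x assume "x \<in> {x \<in> set xs. x \<le> Min B}"
      then obtain X where X: "X \<in> C" "x = Min X" "Min X \<le> Min B" using xs(1) by auto
      have "B \<in> C" using C(2) B Min_less_Max[OF B] by auto
      with X cmp[of X B] nested_iff[of X B] nested_iff[of B X] sub B Min_less_Max[OF B]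
      have "Min B < Max X" by auto
      with X sub show "x \<in> openers \<pi> (Min B)" by (auto simp: openers_def)
    next
      fix x assume "x \<in> openers \<pi> (Min B)"
      then show "x \<in> {x \<in> set xs. x \<le> Min B}" using xs(1) C(2) by (auto simp: openers_def)
    qed
    finally have "sorted_list_of_set (openers \<pi> (Min B)) = takeWhile (\<lambda>x. x \<le> Min B) xs"
      unfolding tw using xs(2) by (intro sorted_list_of_set_eqI sorted_wrt_filter)
    moreover have "rev (map L (map (block_of \<pi>) xs)) =
        map (\<lambda>x. L (block_of \<pi> x)) (rev (dropWhile (\<lambda>x. x \<le> Min B) xs)) @
        map (\<lambda>x. L (block_of \<pi> x)) (rev (takeWhile (\<lambda>x. x \<le> Min B) xs))"
      unfolding map_append[symmetric] rev_append[symmetric] takeWhile_dropWhile_id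
      by (simp add: rev_map o_def)
    ultimately show "vword (open_word \<pi> L (Min B))"
      using vw vword_appendD unfolding open_word_def by metis
  qed
next
  assume W: "\<forall>B\<in>\<pi>. vword (open_word \<pi> L (Min B))"
  show "V_monotone \<pi> L"
    unfolding V_monotone_def
  proof (intro allI impI, elim conjE)
    fix Bs assume s: "sorted_wrt nested Bs" and m: "pred_on.maxchain \<pi> nested (set Bs)"
    have ch: "pred_on.chain \<pi> nested (set Bs)"
      and mx: "\<And>D. pred_on.chain \<pi> nested D \<Longrightarrow> set Bs \<subseteq> D \<Longrightarrow> set Bs = D"
      using m by (auto simp: pred_on.maxchain_def)
    have sub: "set Bs \<subseteq> \<pi>" using ch by (auto simp: pred_on.chain_def)
    show "vword (rev (map L Bs))"
    proof (cases "Bs = []")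
      case False
      define B where "B = last Bs"
      have B: "B \<in> \<pi>" "B \<in> set Bs" using False sub by (auto simp: B_def)
      have anc: "Min X \<le> Min B \<and> Min B < Max X" if "X \<in> set Bs" for X
      proof (cases "X = B")
        case True
        then show ?thesis using Min_less_Max[OF B(1)] by simp
      next
        case ne: False
        have split: "Bs = butlast Bs @ [B]" using False by (simp add: B_def)
        then have "set Bs = insert B (set (butlast Bs))"
          by (metis list.simps(15) rotate1.simps(2) set_rotate1)
        with that ne have "X \<in> set (butlast Bs)" by blast
        moreover have "sorted_wrt nested (butlast Bs @ [B])" using s split by metis
        ultimately have "nested X B"
          unfolding sorted_wrt_append by simp
        then show ?thesis using nested_iff[of B X] B sub that by auto
      qed
      have "set Bs = {X \<in> \<pi>. Min X \<le> Min B \<and> Min B < Max X}"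
      proof (intro equalityI subsetI)
        fix X assume X: "X \<in> {X \<in> \<pi>. Min X \<le> Min B \<and> Min B < Max X}"
        have "nested X Y \<or> X = Y \<or> nested Y X" if "Y \<in> set Bs" for Y
          using X that anc[OF that] sub nested_iff[of X Y] nested_iff[of Y X] Min_block_inject[of X Y]
          by (cases "Min X" "Min Y" rule: linorder_cases) auto
        then have "pred_on.chain \<pi> nested (insert X (set Bs))"
          using ch X by (auto simp: pred_on.chain_def)
        then show "X \<in> set Bs" using mx by blast
      qed (use anc sub in auto)
      then have "set (map Min Bs) = openers \<pi> (Min B)"
        by (simp add: openers_def)
      moreover have "sorted_wrt (<) (map Min Bs)"
        unfolding sorted_wrt_map
        by (rule sorted_wrt_mono_rel[OF _ s]) (use nested_iff sub in auto)
      ultimately have "sorted_list_of_set (openers \<pi> (Min B)) = map Min Bs"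
        by (intro sorted_list_of_set_eqI)
      then have "open_word \<pi> L (Min B) = rev (map (\<lambda>X. L (block_of \<pi> (Min X))) Bs)"
        by (simp add: open_word_def rev_map o_def)
      also have "map (\<lambda>X. L (block_of \<pi> (Min X))) Bs = map L Bs"
        using sub by (intro map_cong) auto
      finally show ?thesis using W B by metis
    qed simp
  qed
qed

section \<open>The bijection between partitions and closed paths\<close>

lemma blocks_eq_fibres:
  "\<pi> = (\<lambda>s. {t \<in> {1..n}. Min (block_of \<pi> t) = Min (block_of \<pi> s)}) ` {1..n}"
proof -
  have fib: "{t \<in> {1..n}. Min (block_of \<pi> t) = Min (block_of \<pi> s)} = block_of \<pi> s"
    if s: "s \<in> {1..n}" for s
  proof (intro equalityI subsetI)
    fix t assume t: "t \<in> {t \<in> {1..n}. Min (block_of \<pi> t) = Min (block_of \<pi> s)}"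
    then have "block_of \<pi> t = block_of \<pi> s"
      using block_of(1)[of t] block_of(1)[OF s] by (intro Min_block_inject) auto
    then show "t \<in> block_of \<pi> s" using t block_of(2)[of t] by auto
  next
    fix t assume t: "t \<in> block_of \<pi> s"
    have "block_of \<pi> t = block_of \<pi> s" by (rule block_of_eq[OF block_of(1)[OF s] t])
    moreover have "t \<in> {1..n}" using t block_subset[OF block_of(1)[OF s]] by blast
    ultimately show "t \<in> {t \<in> {1..n}. Min (block_of \<pi> t) = Min (block_of \<pi> s)}" by simp
  qed
  have "\<pi> = block_of \<pi> ` {1..n}"
  proof (intro equalityI subsetI)
    fix B assume B: "B \<in> \<pi>"
    then have "Min B \<in> {1..n}" using Min_in_block block_subset by blast
    then show "B \<in> block_of \<pi> ` {1..n}" using block_of_Min[OF B] by (metis imageI)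
  qed (use block_of(1) in blast)
  also have "\<dots> = (\<lambda>s. {t \<in> {1..n}. Min (block_of \<pi> t) = Min (block_of \<pi> s)}) ` {1..n}"
    by (intro image_cong refl fib[symmetric])
  finally show ?thesis .
qed

end

text \<open>The path determines the opening times \<open>opener\<close>, whose fibres are the blocks, and the label of a
  block is the one pushed at its opening time.\<close>

lemma inj_path_of: "inj_on (\<lambda>(\<pi>, L). path_of \<pi> L n) (LV2 N n k)"
proof (intro inj_onI, clarify)
  fix \<pi> L \<pi>' L'
  assume a: "(\<pi>, L) \<in> LV2 N n k" "(\<pi>', L') \<in> LV2 N n k" and eq: "path_of \<pi> L n = path_of \<pi>' L' n"
  interpret a: nc2_partition \<pi> n by standard (use a in \<open>auto simp: LV2_def\<close>)
  interpret b: nc2_partition \<pi>' n by standard (use a in \<open>auto simp: LV2_def\<close>)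
  have "Min (block_of \<pi> s) = Min (block_of \<pi>' s)" if "s \<in> {1..n}" for s
  proof -
    have "opener (path_of \<pi> L n) s = Min (block_of \<pi> s)" using a.path_of_invariant[of n L] that by blast
    moreover have "opener (path_of \<pi>' L' n) s = Min (block_of \<pi>' s)"
      using b.path_of_invariant[of n L'] that by blast
    ultimately show ?thesis using eq by simp
  qed
  then have pi: "\<pi> = \<pi>'"
    by (subst a.blocks_eq_fibres, subst b.blocks_eq_fibres, intro image_cong) auto
  have "L B = L' B" if "B \<in> \<pi>" for B
  proof -
    have "Min B \<le> n" using that a.Min_in_block a.block_subset by fastforce
    then show ?thesis using a.pushed_label_path_of[OF that, of n L] b.pushed_label_path_of[of B n L'] that pi eq by metis
  qed
  then have "L = L'"
    using a pi by (intro PiE_ext[of L \<pi> "\<lambda>_. {1..N}" L']) (auto simp: LV2_def)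
  with pi show "\<pi> = \<pi>' \<and> L = L'" by blast
qed

definition path_blocks :: "step list \<Rightarrow> nat set set" where
  "path_blocks p = (\<lambda>x. {t \<in> {1..length p}. opener p t = x}) ` opener p ` {1..length p}"

text \<open>Two crossing blocks \<open>a < b < c < d\<close> would each be opened no later than the other by
  \<open>opener_nested\<close>. A block contains its opening step, which is a push, and, the final stack being
  empty, also a pop.\<close>

lemma path_blocks_NC2:
  assumes wf: "wf_path p" and closed: "open_times p = []"
  shows "path_blocks p \<in> NC2 (length p)"
proof -
  have part: "partition_on {1..length p} (path_blocks p)"
  proof (rule partition_onI)
    show "\<Union>(path_blocks p) = {1..length p}" by (auto simp: path_blocks_def)
    show "disjnt B B'" if "B \<in> path_blocks p" "B' \<in> path_blocks p" "B \<noteq> B'" for B B'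
    proof -
      obtain x y where "B = {t \<in> {1..length p}. opener p t = x}" "B' = {t \<in> {1..length p}. opener p t = y}"
        using \<open>B \<in> path_blocks p\<close> \<open>B' \<in> path_blocks p\<close> by (auto simp: path_blocks_def)
      with \<open>B \<noteq> B'\<close> show ?thesis by (auto simp: disjnt_def)
    qed
    show "{} \<notin> path_blocks p" by (auto simp: path_blocks_def)
  qed
  have "noncrossing (path_blocks p)"
    unfolding noncrossing_def
  proof (intro ballI impI notI, elim bexE conjE)
    fix B B' a b c d
    assume B: "B \<in> path_blocks p" "B' \<in> path_blocks p" "B \<noteq> B'"
      and mem: "a \<in> B" "b \<in> B'" "c \<in> B" "d \<in> B'" and less: "a < b" "b < c" "c < d"
    have r: "a \<in> {1..length p}" "b \<in> {1..length p}" "c \<in> {1..length p}" "d \<in> {1..length p}"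
      and eq: "opener p a = opener p c" "opener p b = opener p d"
      using B mem by (auto simp: path_blocks_def)
    have "opener p c \<le> opener p b"
      using opener_nested[OF wf, of c b] opener_range[OF wf r(1)] eq less r by auto
    moreover have "opener p d \<le> opener p c"
      using opener_nested[OF wf, of d c] opener_range[OF wf r(2)] eq less r by auto
    ultimately have "opener p b = opener p c" using eq by simp
    then show False using B mem by (auto simp: path_blocks_def)
  qed
  moreover have "2 \<le> card B" if B: "B \<in> path_blocks p" for B
  proof -
    obtain t where t: "t \<in> {1..length p}" "B = {s \<in> {1..length p}. opener p s = opener p t}"
      using B by (auto simp: path_blocks_def)
    obtain s where s: "s \<in> {1..length p}" "step_at p s = Pop" "opener p s = opener p t"
      using closed_by_Pop[OF wf t(1)] closed by auto
    let ?x = "opener p t"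
    have x: "?x \<in> {1..length p}" "opener p ?x = ?x"
      using opener_range[OF wf t(1)] t opener_opener[OF wf t(1)] by auto
    have "?x \<noteq> s" using step_at_Push_iff[OF wf x(1)] x(2) s by auto
    moreover have "{?x, s} \<subseteq> B" using t s x by auto
    moreover have "finite B" using t by simp
    ultimately show ?thesis using card_mono[of B "{?x, s}"] by simp
  qed
  ultimately show ?thesis using part by (simp add: NC2_def)
qed

text \<open>The blocks of a closed path are labelled by what was pushed at their opening. Reading the steps
  of this partition gives the path back, because pushes happen at minima and pops at maxima; the
  V-property is then that of the words along the path.\<close>

lemma path_of_surj:
  assumes p: "p \<in> paths N n" "stack p = []" "pushes p = k"
  shows "p \<in> (\<lambda>(\<pi>, L). path_of \<pi> L n) ` LV2 N n k"
proof -
  have wf: "wf_path p" and closed: "open_times p = []" and len: "length p = n"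
    using p paths_wf paths_length by (auto simp: stack_Nil_iff)
  define \<pi> where "\<pi> = path_blocks p"
  define L where "L = restrict (\<lambda>B. pushed_label p (Min B)) \<pi>"
  interpret nc2_partition \<pi> n
    by standard (use path_blocks_NC2[OF wf closed] in \<open>simp add: \<pi>_def len\<close>)
  have blk: "block_of \<pi> t = {s \<in> {1..n}. opener p s = opener p t}" if "t \<in> {1..n}" for t
    using that by (intro block_of_eq) (auto simp: \<pi>_def path_blocks_def len)
  have Min: "Min (block_of \<pi> t) = opener p t" if "t \<in> {1..n}" for t
  proof (rule Min_eqI)
    show "finite (block_of \<pi> t)" using that by (simp add: blk)
    show "opener p t \<in> block_of \<pi> t"
      using that opener_range[OF wf, of t] opener_opener[OF wf, of t] by (auto simp: blk len)
    show "opener p t \<le> s" if "s \<in> block_of \<pi> t" for s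
      using that \<open>t \<in> {1..n}\<close> opener_range[OF wf, of s] by (auto simp: blk len)
  qed
  have Max: "Max (block_of \<pi> t) = s" if "t \<in> {1..n}" "s \<in> {1..n}" "opener p s = opener p t" "step_at p s = Pop" for s t
    using that closed_after_Pop[OF wf, of s] by (intro Max_eqI) (auto simp: blk len)
  have pop: "step_at p t = Pop \<longleftrightarrow> Max (block_of \<pi> t) = t" if t: "t \<in> {1..n}" for t
  proof -
    obtain s where s: "s \<in> {1..n}" "step_at p s = Pop" "opener p s = opener p t"
      using closed_by_Pop[OF wf, of t] closed t len by auto
    from Max[OF t s(1,3,2)] Max[OF t t refl] s(2) show ?thesis by metis
  qed
  have step_of: "step_of \<pi> L t = step_at p t" if t: "t \<in> {1..n}" for t
  proof (cases "step_at p t")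
    case (Push i)
    then have "opener p t = t" using step_at_Push_iff[OF wf, of t] t len by auto
    then show ?thesis using Push t block_of[OF t] by (simp add: step_of_def Let_def Min L_def pushed_label_def)
  next
    case Stay
    then have "opener p t \<noteq> t" using step_at_Push_iff[OF wf, of t] t len by auto
    then show ?thesis using Stay t pop[OF t] by (simp add: step_of_def Let_def Min)
  next
    case Pop
    then have "opener p t \<noteq> t" using step_at_Push_iff[OF wf, of t] t len by auto
    then show ?thesis using Pop t pop[OF t] by (simp add: step_of_def Let_def Min)
  qed
  have path_of: "path_of \<pi> L n = p"
    using path_of_eqI[of p \<pi> L] step_of len by simp
  have "V_monotone \<pi> L"
    unfolding V_monotone_iff
  proof
    fix B assume "B \<in> \<pi>"
    then have "Min B \<le> n" using Min_in_block block_subset by fastforce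
    then show "vword (open_word \<pi> L (Min B))" using open_word_vword path_of p(1) by simp
  qed
  moreover have "L \<in> \<pi> \<rightarrow>\<^sub>E {1..N}"
  proof
    fix B assume B: "B \<in> \<pi>"
    then have r: "Min B \<in> {1..n}" using Min_in_block block_subset by blast
    have "opener p (Min B) = Min B" using Min[OF r] B by simp
    then obtain i where i: "step_at p (Min B) = Push i"
      using step_at_Push_iff[OF wf] r len by blast
    have "i \<in> {1..N}" using paths_labels[OF p(1) _ i] r len by simp
    then show "L B \<in> {1..N}" using i B by (simp add: L_def pushed_label_def)
  qed (simp add: L_def)
  moreover have "card \<pi> = k" using pushes_path_of[of L] path_of p(3) by simp
  ultimately have "(\<pi>, L) \<in> LV2 N n k" using NC2 by (simp add: LV2_def)
  then show ?thesis using path_of by force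
qed

lemma bij_path_of:
  "bij_betw (\<lambda>(\<pi>, L). path_of \<pi> L n) (LV2 N n k) {p \<in> paths N n. stack p = [] \<and> pushes p = k}"
  unfolding bij_betw_def
proof (intro conjI inj_path_of equalityI subsetI)
  fix p assume "p \<in> (\<lambda>(\<pi>, L). path_of \<pi> L n) ` LV2 N n k"
  then obtain \<pi> L where L: "(\<pi>, L) \<in> LV2 N n k" "p = path_of \<pi> L n" by auto
  interpret nc2_partition \<pi> n by standard (use L in \<open>auto simp: LV2_def\<close>)
  have "p \<in> paths N n"
    unfolding L(2) using L(1) V_monotone_iff[of L]
    by (intro path_of_in_paths) (auto simp: LV2_def)
  then show "p \<in> {p \<in> paths N n. stack p = [] \<and> pushes p = k}"
    using L path_of_closed pushes_path_of by (auto simp: LV2_def stack_Nil_iff)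
qed (use path_of_surj in blast)

theorem theorem4p3:
  fixes N n :: nat and lam :: real
  assumes "1 \<le> N"
  shows "moment n lam N =
    of_real (\<Sum>k = 0..n div 2. real (card (LV2 N n k)) / real N ^ k * lam ^ (n - 2 * k))"
  by (simp add: moment_eq_count_paths bij_betw_same_card[OF bij_path_of])

end
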